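(* Let $\lambda<0$, and for $i=1,2$ let $A_i,B_i$ be strictly positive operators on a Hilbert space $\mathcal{H}_i$. (1) If $0<A_i\leq B_i$ for $i=1,2$, then (a') $\widetilde{T_{\lambda}}(A_1\otimes A_2\vert B_1\otimes B_2)\geq \lambda\,\widetilde{T_{\lambda}}(A_1\vert B_1)\otimes \widetilde{T_{\lambda}}(A_2\vert B_2)$; (b') $\widetilde{T_{\lambda}}(A_1\otimes A_2\vert B_1\otimes B_2)\leq \widetilde{T_{\lambda}}(A_1\vert B_1)\otimes A_2+A_1\otimes \widetilde{T_{\lambda}}(A_2\vert B_2)$. (2) If $0<B_i\leq A_i$ for $i=1,2$, then (c') $\widetilde{T_{\lambda}}(A_1\otimes A_2\vert B_1\otimes B_2)\leq \lambda\,\widetilde{T_{\lambda}}(A_1\vert B_1)\otimes \widetilde{T_{\lambda}}(A_2\vert B_2)$; (d') $\widetilde{T_{\lambda}}(A_1\otimes A_2\vert B_1\otimes B_2)\leq \widetilde{T_{\lambda}}(A_1\vert B_1)\otimes A_2+A_1\otimes \widetilde{T_{\lambda}}(A_2\vert B_2)$.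
   Context: Operators are bounded linear operators on a Hilbert space; $X\leq Y$ means that $Y-X$ is positive (semidefinite), and strictly positive ($X>0$) means positive and invertible. For strictly positive operators $A,B$ on the same Hilbert space and $\lambda<0$, define $\widetilde{T_{\lambda}}(A\vert B):=\frac{1}{\lambda}\left(A^{1/2}(A^{-1/2}BA^{-1/2})^{\lambda}A^{1/2}-A\right)$. The symbol $\otimes$ denotes the tensor product of operators, acting on the Hilbert space tensor product $\mathcal{H}_1\otimes\mathcal{H}_2$. *)

theory Defs
  imports "HOL-Analysis.Analysis" "HOL-Computational_Algebra.Polynomial"
begin

text \<open>Complex Hilbert spaces, as complete real inner product spaces carrying a compatible complex
  structure. The complex inner product is linear in the second argument, and its real part is the
  real inner product of the underlying real space, so \<^const>\<open>norm\<close> is the Hilbert space norm.\<close>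

class chilbert_space = real_inner + complete_space +
  fixes scaleC :: "complex \<Rightarrow> 'a \<Rightarrow> 'a" (infixr "*\<^sub>C" 75)
    and cinner :: "'a \<Rightarrow> 'a \<Rightarrow> complex"
  assumes scaleC_add_right: "c *\<^sub>C (x + y) = c *\<^sub>C x + c *\<^sub>C y"
    and scaleC_add_left: "(c + d) *\<^sub>C x = c *\<^sub>C x + d *\<^sub>C x"
    and scaleC_scaleC: "c *\<^sub>C d *\<^sub>C x = (c * d) *\<^sub>C x"
    and scaleC_of_real: "complex_of_real r *\<^sub>C x = r *\<^sub>R x"
    and cinner_commute: "cinner x y = cnj (cinner y x)"
    and cinner_add_right: "cinner x (y + z) = cinner x y + cinner x z"
    and cinner_scaleC_right: "cinner x (c *\<^sub>C y) = c * cinner x y"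
    and Re_cinner: "Re (cinner x y) = inner x y"

subclass (in chilbert_space) banach ..

instantiation complex :: chilbert_space
begin

definition scaleC_complex :: "complex \<Rightarrow> complex \<Rightarrow> complex" where
  "scaleC_complex c x = c * x"

definition cinner_complex :: "complex \<Rightarrow> complex \<Rightarrow> complex" where
  "cinner_complex x y = cnj x * y"

instance
  by standard (auto simp: scaleC_complex_def cinner_complex_def inner_complex_def algebra_simps
      scaleR_conv_of_real)

end

text \<open>The type \<^typ>\<open>'a \<Rightarrow>\<^sub>L 'b\<close> only provides real-linear bounded operators; the bounded
  operators between complex Hilbert spaces are those that also commute with complex scalars.\<close>

definition clinear_op :: "('a::chilbert_space \<Rightarrow>\<^sub>L 'b::chilbert_space) \<Rightarrow> bool" where
  "clinear_op A \<longleftrightarrow> (\<forall>c x. A (c *\<^sub>C x) = c *\<^sub>C A x)"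

definition positive_op :: "('a::chilbert_space \<Rightarrow>\<^sub>L 'a) \<Rightarrow> bool" where
  "positive_op A \<longleftrightarrow> clinear_op A \<and> (\<forall>x. cinner x (A x) \<in> \<real>\<^sub>\<ge>\<^sub>0)"

definition op_le :: "('a::chilbert_space \<Rightarrow>\<^sub>L 'a) \<Rightarrow> ('a \<Rightarrow>\<^sub>L 'a) \<Rightarrow> bool"
    (infix "\<preceq>" 50) where
  "A \<preceq> B \<longleftrightarrow> positive_op (B - A)"

definition invertible_op :: "('a::chilbert_space \<Rightarrow>\<^sub>L 'a) \<Rightarrow> bool" where
  "invertible_op A \<longleftrightarrow>
     (\<exists>C. clinear_op C \<and> A o\<^sub>L C = id_blinfun \<and> C o\<^sub>L A = id_blinfun)"

definition strictly_positive :: "('a::chilbert_space \<Rightarrow>\<^sub>L 'a) \<Rightarrow> bool" where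
  "strictly_positive A \<longleftrightarrow> positive_op A \<and> invertible_op A"

lemma bounded_linear_scaleC: "bounded_linear (\<lambda>x::'a::chilbert_space. c *\<^sub>C x)"
proof (rule bounded_linear_intro[where K = "cmod c"])
  fix x y :: 'a and r :: real
  show "c *\<^sub>C (x + y) = c *\<^sub>C x + c *\<^sub>C y"
    by (rule scaleC_add_right)
  show "c *\<^sub>C r *\<^sub>R x = r *\<^sub>R c *\<^sub>C x"
    by (metis scaleC_of_real scaleC_scaleC mult.commute)
  have "cinner (c *\<^sub>C x) (c *\<^sub>C x) = c * cnj c * cinner x x"
    by (metis cinner_commute cinner_scaleC_right complex_cnj_cnj complex_cnj_mult mult.assoc)
  then have "Re (cinner (c *\<^sub>C x) (c *\<^sub>C x)) = (cmod c)\<^sup>2 * Re (cinner x x)"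
    by (simp add: complex_norm_square [symmetric] del: of_real_power)
  then have "(norm (c *\<^sub>C x))\<^sup>2 = (norm x * cmod c)\<^sup>2"
    by (simp add: Re_cinner power2_norm_eq_inner power_mult_distrib mult.commute)
  then have "norm (c *\<^sub>C x) = norm x * cmod c"
    by (simp add: power2_eq_iff_nonneg)
  then show "norm (c *\<^sub>C x) \<le> norm x * cmod c"
    by simp
qed

definition scalar_op :: "complex \<Rightarrow> 'a::chilbert_space \<Rightarrow>\<^sub>L 'a" where
  "scalar_op c = Blinfun (\<lambda>x. c *\<^sub>C x)"

lemma scalar_op_apply [simp]: "scalar_op c x = c *\<^sub>C x"
  by (simp add: scalar_op_def bounded_linear_Blinfun_apply bounded_linear_scaleC)

definition op_spectrum :: "('a::chilbert_space \<Rightarrow>\<^sub>L 'a) \<Rightarrow> complex set" where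
  "op_spectrum A = {z. \<not> invertible_op (A - scalar_op z)}"

definition poly_op :: "real poly \<Rightarrow> ('a::chilbert_space \<Rightarrow>\<^sub>L 'a) \<Rightarrow> 'a \<Rightarrow>\<^sub>L 'a" where
  "poly_op p A = (\<Sum>i\<le>degree p. coeff p i *\<^sub>R (((o\<^sub>L) A ^^ i) id_blinfun))"

text \<open>Continuous functional calculus \<open>f(A)\<close> for self-adjoint \<open>A\<close> (so that the spectrum is real) and
  \<open>f\<close> real-valued and continuous on the spectrum: the norm limit of \<open>p\<^sub>n(A)\<close> for any real polynomials
  \<open>p\<^sub>n\<close> converging to \<open>f\<close> uniformly on the spectrum of \<open>A\<close>.\<close>

definition fun_calc :: "(real \<Rightarrow> real) \<Rightarrow> ('a::chilbert_space \<Rightarrow>\<^sub>L 'a) \<Rightarrow> 'a \<Rightarrow>\<^sub>L 'a" where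
  "fun_calc f A = (THE C. \<forall>p :: nat \<Rightarrow> real poly.
     uniform_limit {x. complex_of_real x \<in> op_spectrum A} (\<lambda>n. poly (p n)) f sequentially
       \<longrightarrow> (\<lambda>n. poly_op (p n) A) \<longlonglongrightarrow> C)"

text \<open>Used only for strictly positive \<open>A\<close>, whose spectrum lies in \<open>{0<..}\<close>.\<close>

definition op_powr :: "('a::chilbert_space \<Rightarrow>\<^sub>L 'a) \<Rightarrow> real \<Rightarrow> 'a \<Rightarrow>\<^sub>L 'a" where
  "op_powr A s = fun_calc (\<lambda>x. x powr s) A"

definition T_tilde ::
    "real \<Rightarrow> ('a::chilbert_space \<Rightarrow>\<^sub>L 'a) \<Rightarrow> ('a \<Rightarrow>\<^sub>L 'a) \<Rightarrow> 'a \<Rightarrow>\<^sub>L 'a" where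
  "T_tilde l A B = (1 / l) *\<^sub>R
     ((op_powr A (1/2) o\<^sub>L op_powr (op_powr A (-1/2) o\<^sub>L B o\<^sub>L op_powr A (-1/2)) l
        o\<^sub>L op_powr A (1/2)) - A)"

text \<open>The Hilbert space tensor product, up to unitary isomorphism: a Hilbert space \<open>'c\<close> with a
  complex bilinear map \<open>(x, y) \<mapsto> x \<otimes> y\<close> that multiplies inner products and whose values
  span a dense subspace. The real span suffices, because the range of a complex bilinear map is
  closed under complex scalars.\<close>

definition hilbert_tensor ::
    "('a::chilbert_space \<Rightarrow> 'b::chilbert_space \<Rightarrow> 'c::chilbert_space) \<Rightarrow> bool" where
  "hilbert_tensor t \<longleftrightarrow>
     (\<forall>x x' y. t (x + x') y = t x y + t x' y) \<and>
     (\<forall>x y y'. t x (y + y') = t x y + t x y') \<and>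
     (\<forall>c x y. t (c *\<^sub>C x) y = c *\<^sub>C t x y) \<and>
     (\<forall>c x y. t x (c *\<^sub>C y) = c *\<^sub>C t x y) \<and>
     (\<forall>x x' y y'. cinner (t x y) (t x' y') = cinner x x' * cinner y y') \<and>
     closure (span {t x y | x y. True}) = UNIV"

text \<open>For instance, \<open>\<complex> \<otimes> H\<close> is \<open>H\<close>, with \<open>z \<otimes> x = z x\<close>.\<close>

lemma hilbert_tensor_scaleC: "hilbert_tensor ((*\<^sub>C) :: complex \<Rightarrow> 'a::chilbert_space \<Rightarrow> 'a)"
proof -
  have cl: "cinner (c *\<^sub>C x) y = cnj c * cinner x y" for c and x y :: 'a
    by (metis cinner_commute cinner_scaleC_right complex_cnj_mult)
  have "x = complex_of_real 1 *\<^sub>C x" for x :: 'a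
    by (simp only: scaleC_of_real scaleR_one)
  then have "{c *\<^sub>C x | c x. True} = (UNIV :: 'a set)"
    by blast
  then show ?thesis
    unfolding hilbert_tensor_def
    by (simp add: scaleC_add_left scaleC_add_right scaleC_scaleC scaleC_complex_def
        cinner_complex_def cl cinner_scaleC_right mult_ac)
qed

text \<open>\<open>A \<otimes> B\<close> is the unique bounded operator with \<open>(A \<otimes> B) (x \<otimes> y) = A x \<otimes> B y\<close>.\<close>

definition tensor_op ::
    "('a::chilbert_space \<Rightarrow> 'b::chilbert_space \<Rightarrow> 'c::chilbert_space)
       \<Rightarrow> ('a \<Rightarrow>\<^sub>L 'a) \<Rightarrow> ('b \<Rightarrow>\<^sub>L 'b) \<Rightarrow> 'c \<Rightarrow>\<^sub>L 'c" where
  "tensor_op t A B = (THE C. clinear_op C \<and> (\<forall>x y. C (t x y) = t (A x) (B y)))"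

end

(* Put X_i = A_i^{1/2} (A_i^{-1/2} B_i A_i^{-1/2})^l A_i^{1/2} and T_i = (X_i - A_i) / l. Real powers
   are multiplicative on tensor products, so the operator X of the pair (A_1 (x) A_2, B_1 (x) B_2) is
   X_1 (x) X_2; expanding (A_1 + l T_1) (x) (A_2 + l T_2) gives
     T = T_1 (x) A_2 + A_1 (x) T_2 + l T_1 (x) T_2.
   If A_i <= B_i then A_i^{-1/2} B_i A_i^{-1/2} >= 1, so X_i <= A_i and T_i >= 0 (as l < 0); if
   B_i <= A_i then T_i <= 0. Tensor products of positive operators are positive, which gives the
   four inequalities.

   (A (x) B)^s = A^s (x) B^s holds for s = 1 and is preserved under sums, negatives, halves
   (uniqueness of positive square roots) and limits in s, hence it holds for all real s. *)
theory Submission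
  imports Defs "HOL-Computational_Algebra.Fundamental_Theorem_Algebra"
begin

section \<open>Self-adjoint operators\<close>

text \<open>The powers in \<open>T_tilde\<close> are limits of polynomials in an operator, where
  convergence is prescribed only on the spectrum. All their properties rest on one estimate,
  \<open>norm_poly_op_le\<close>: the norm of p(A) is at most any bound for |p| on the real spectral
  points. Two facts yield it. On a nonzero space, m^2 - S^2 with S self-adjoint and m =
  \<open>norm S\<close> is never invertible; and q(A) is invertible when the real polynomial q is
  nonzero and has no zero on the spectrum. Taking S = p(A) and q = m^2 - p^2, these are incompatible
  if |p| stays below m on the spectrum.

  The tensor product is known only through \<open>hilbert_tensor\<close>, so the operator A (x) B
  has to be constructed. Its formula on sums of elementary tensors is not obviously single-valued;
  an exact norm identity settles this together with boundedness.

  The passage through dyadic exponents means that the spectrum of A (x) B never has to be computed: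
  only products, inverses, square roots and continuity in the exponent are compared.\<close>

definition selfadj :: "('a::chilbert_space \<Rightarrow>\<^sub>L 'a) \<Rightarrow> bool" where
  "selfadj A \<longleftrightarrow> clinear_op A \<and> (\<forall>x y. inner (A x) y = inner x (A y))"

text \<open>The interval stands in for the spectrum, whose real points it contains by
  \<open>between_spectrum\<close>; continuity and approximation can then be handled on a compact
  interval. On the zero space a > b is possible.\<close>

definition between_op :: "real \<Rightarrow> real \<Rightarrow> ('a::chilbert_space \<Rightarrow>\<^sub>L 'a) \<Rightarrow> bool" where
  "between_op a b A \<longleftrightarrow> selfadj A \<and>
     (\<forall>x. a * (norm x)\<^sup>2 \<le> inner x (A x) \<and> inner x (A x) \<le> b * (norm x)\<^sup>2)"

lemma selfadj_clinear: "selfadj A \<Longrightarrow> clinear_op A"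
  and selfadjD: "selfadj A \<Longrightarrow> inner (A x) y = inner x (A y)"
  by (auto simp: selfadj_def)

lemma clinear_opD: "clinear_op A \<Longrightarrow> A (c *\<^sub>C x) = c *\<^sub>C A x"
  by (simp add: clinear_op_def)

lemma between_op_selfadj: "between_op a b A \<Longrightarrow> selfadj A"
  and between_op_lower: "between_op a b A \<Longrightarrow> a * (norm x)\<^sup>2 \<le> inner x (A x)"
  and between_op_upper: "between_op a b A \<Longrightarrow> inner x (A x) \<le> b * (norm x)\<^sup>2"
  by (auto simp: between_op_def)

lemma cinner_add_left: "cinner (x + y) z = cinner x z + cinner y z"
  by (metis cinner_add_right cinner_commute complex_cnj_add)

lemma cinner_scaleC_left: "cinner (c *\<^sub>C x) y = cnj c * cinner x y"
  by (metis cinner_commute cinner_scaleC_right complex_cnj_mult)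

lemma scaleC_minus_right: "c *\<^sub>C (- x) = - (c *\<^sub>C x)"
  by (metis add_eq_0_iff scaleC_add_right add.right_inverse add_cancel_right_right)

lemma scaleC_diff_right: "c *\<^sub>C (x - y) = c *\<^sub>C x - c *\<^sub>C y"
  by (metis diff_conv_add_uminus scaleC_add_right scaleC_minus_right)

lemma scaleC_zero_right: "c *\<^sub>C 0 = 0"
  by (metis scaleC_diff_right diff_self)

lemma scaleC_scaleR: "c *\<^sub>C (r *\<^sub>R x) = r *\<^sub>R (c *\<^sub>C x)"
  by (metis scaleC_of_real scaleC_scaleC mult.commute)

text \<open>The real part of the inner product of x with i y is minus the imaginary part of that of
  x with y. Symmetry for \<open>inner\<close> can thus be lifted to \<open>cinner\<close>.\<close>

lemma cinner_ii: "cinner x y = complex_of_real (inner x y) - \<i> * complex_of_real (inner x (\<i> *\<^sub>C y))"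
  using cinner_scaleC_right[of x \<i> y] Re_cinner[of x y] Re_cinner[of x "\<i> *\<^sub>C y"]
  by (simp add: complex_eq_iff)

lemma positive_op_iff:
  "positive_op A \<longleftrightarrow> selfadj A \<and> (\<forall>x. 0 \<le> inner x (A x))"
proof
  assume p: "positive_op A"
  then have cl: "clinear_op A" and nn: "\<And>x. cinner x (A x) \<in> \<real>\<^sub>\<ge>\<^sub>0"
    by (auto simp: positive_op_def)
  have im: "Im (cinner x (A x)) = 0" for x
    using nn[of x] by (simp add: complex_nonneg_Reals_iff)
  have "inner (A x) y = inner x (A y)" for x y
  proof -
    \<comment> \<open>Polarization: the diagonal terms of the expansion are real, and the cross
      terms have imaginary part Re \<open>cinner x (A y)\<close> - Re
      \<open>cinner y (A x)\<close>.\<close>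
    have "Im (cinner (x + \<i> *\<^sub>C y) (A (x + \<i> *\<^sub>C y))) = 0" by (rule im)
    then have "Re (cinner x (A y)) = Re (cinner y (A x))"
      by (simp add: blinfun.add_right clinear_opD[OF cl] cinner_add_left cinner_add_right
          cinner_scaleC_left cinner_scaleC_right im)
    then show ?thesis by (simp add: Re_cinner inner_commute)
  qed
  moreover have "0 \<le> inner x (A x)" for x
    using nn[of x] by (simp add: complex_nonneg_Reals_iff Re_cinner)
  ultimately show "selfadj A \<and> (\<forall>x. 0 \<le> inner x (A x))"
    using cl by (auto simp: selfadj_def)
next
  assume r: "selfadj A \<and> (\<forall>x. 0 \<le> inner x (A x))"
  then have cl: "clinear_op A" by (simp add: selfadj_def)
  have "Im (cinner x (A x)) = 0" for x
  proof -
    \<comment> \<open>Symmetry against i x says that \<open>cinner x (A x)\<close> and its conjugate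
      have the same imaginary part.\<close>
    have "inner x (A (\<i> *\<^sub>C x)) = inner (A x) (\<i> *\<^sub>C x)" using r by (simp add: selfadj_def)
    then have "Re (cinner x (\<i> *\<^sub>C A x)) = Re (cinner (A x) (\<i> *\<^sub>C x))"
      by (simp add: Re_cinner clinear_opD[OF cl])
    then show ?thesis
      using cinner_commute[of x "A x"] by (simp add: cinner_scaleC_right complex_eq_iff)
  qed
  then show "positive_op A"
    using r cl by (simp add: positive_op_def complex_nonneg_Reals_iff Re_cinner)
qed

lemma norm_blinfun_sq:
  fixes A :: "'a::real_normed_vector \<Rightarrow>\<^sub>L 'b::real_normed_vector"
  shows "(norm (A x))\<^sup>2 \<le> (norm A)\<^sup>2 * (norm x)\<^sup>2"
  by (metis norm_blinfun norm_ge_zero power_mono power_mult_distrib)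

lemma inner_blinfun_le:
  fixes A :: "'a::real_inner \<Rightarrow>\<^sub>L 'a"
  shows "inner x (A x) \<le> norm A * (norm x)\<^sup>2"
  using norm_cauchy_schwarz[of x "A x"] mult_left_mono[OF norm_blinfun[of A x], of "norm x"]
  by (simp add: power2_eq_square mult_ac)

lemma between_op_exists:
  assumes "selfadj A"
  shows "between_op (- norm A) (norm A) A"
  using assms inner_blinfun_le[of _ A] inner_blinfun_le[of _ "- A"]
  by (auto simp: between_op_def blinfun.minus_left minus_le_iff)

lemma positive_between: "positive_op A \<Longrightarrow> between_op 0 (norm A) A"
  using between_op_exists[of A] by (auto simp: positive_op_iff between_op_def)

lemma clinear_compose: "clinear_op A \<Longrightarrow> clinear_op B \<Longrightarrow> clinear_op (A o\<^sub>L B)"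
  and clinear_add: "clinear_op A' \<Longrightarrow> clinear_op B' \<Longrightarrow> clinear_op (A' + B')"
  and clinear_diff: "clinear_op A' \<Longrightarrow> clinear_op B' \<Longrightarrow> clinear_op (A' - B')"
  and clinear_scaleR: "clinear_op A \<Longrightarrow> clinear_op (r *\<^sub>R A)"
  and clinear_id: "clinear_op id_blinfun"
  and clinear_zero: "clinear_op 0"
  by (auto simp: clinear_op_def blinfun.add_left blinfun.diff_left blinfun.scaleR_left
      scaleC_add_right scaleC_diff_right scaleC_scaleR scaleC_zero_right)

lemmas clinear_intros =
  clinear_compose clinear_add clinear_diff clinear_scaleR clinear_id clinear_zero

lemma selfadj_add: "selfadj A \<Longrightarrow> selfadj B \<Longrightarrow> selfadj (A + B)"
  and selfadj_diff: "selfadj A \<Longrightarrow> selfadj B \<Longrightarrow> selfadj (A - B)"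
  and selfadj_scaleR: "selfadj A \<Longrightarrow> selfadj (r *\<^sub>R A)"
  and selfadj_id: "selfadj id_blinfun"
  and selfadj_zero: "selfadj 0"
  by (auto simp: selfadj_def blinfun.add_left blinfun.diff_left blinfun.scaleR_left
      inner_add_left inner_add_right inner_diff_left inner_diff_right intro: clinear_intros)

lemma selfadj_sandwich: "selfadj A \<Longrightarrow> selfadj B \<Longrightarrow> selfadj (A o\<^sub>L B o\<^sub>L A)"
  by (auto simp: selfadj_def intro: clinear_intros)

lemma selfadj_square: "selfadj A \<Longrightarrow> selfadj (A o\<^sub>L A)"
  by (auto simp: selfadj_def intro: clinear_intros)

text \<open>The Lax-Milgram argument: T x = y is a fixed point equation for x - c T x + c y, which
  is a contraction for a suitable c > 0; coercivity also gives injectivity and bounds the inverse by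
  1/e.\<close>

lemma coercive_invertible:
  fixes T :: "'a::chilbert_space \<Rightarrow>\<^sub>L 'a"
  assumes cl: "clinear_op T" and e: "0 < e"
    and co: "\<And>x. e * (norm x)\<^sup>2 \<le> inner x (T x)"
  shows "invertible_op T"
proof -
  have lower: "e * norm x \<le> norm (T x)" for x
  proof (cases "x = 0")
    case False
    have "e * norm x * norm x \<le> norm (T x) * norm x"
      using co[of x] norm_cauchy_schwarz[of x "T x"] by (simp add: power2_eq_square mult_ac)
    then show ?thesis using False by simp
  qed simp
  have inj: "x = y" if "T x = T y" for x y
    using lower[of "x - y"] e that by (simp add: blinfun.diff_right mult_le_0_iff)
  \<comment> \<open>Adding e makes M positive and at least e, so the square root in k is real. The
    value c = e/M^2 minimizes 1 - 2 c e + c^2 M^2, and the minimum is k^2.\<close>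
  define M where "M = norm T + e"
  have M: "M > 0" "norm T \<le> M" "e \<le> M" using e by (auto simp: M_def add_nonneg_pos)
  define c where "c = e / M\<^sup>2"
  define k where "k = sqrt (1 - e\<^sup>2 / M\<^sup>2)"
  have eM: "e\<^sup>2 / M\<^sup>2 \<le> 1" "0 < e\<^sup>2 / M\<^sup>2"
    using M e by (auto simp: power_mono)
  have k: "0 \<le> k" "k < 1" "k\<^sup>2 = 1 - e\<^sup>2 / M\<^sup>2" using eM by (auto simp: k_def)
  have contr: "norm (x - c *\<^sub>R T x) \<le> k * norm x" for x
  proof -
    have "(norm (x - c *\<^sub>R T x))\<^sup>2 = (norm x)\<^sup>2 - 2 * c * inner x (T x) + c\<^sup>2 * (norm (T x))\<^sup>2"
      by (simp only: power2_norm_eq_inner)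
        (simp add: inner_diff_left inner_diff_right algebra_simps inner_commute power2_eq_square)
    also have "\<dots> \<le> (norm x)\<^sup>2 - 2 * c * (e * (norm x)\<^sup>2) + c\<^sup>2 * (M\<^sup>2 * (norm x)\<^sup>2)"
    proof -
      have "(norm (T x))\<^sup>2 \<le> M\<^sup>2 * (norm x)\<^sup>2"
        using norm_blinfun_sq[of T x] M(2)
        by (meson mult_right_mono norm_ge_zero order_trans power_mono zero_le_power2)
      moreover have "c \<ge> 0" using e by (simp add: c_def)
      ultimately show ?thesis
        using co[of x] by (intro add_mono diff_mono mult_left_mono) auto
    qed
    also have "\<dots> = (k * norm x)\<^sup>2"
      using M unfolding power_mult_distrib k(3)
      by (simp add: c_def field_simps power2_eq_square)
    finally show ?thesis using k by (simp add: power2_le_iff_abs_le)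
  qed
  have surj: "\<exists>x. T x = y" for y
  proof -
    have "dist ((x - c *\<^sub>R T x) + c *\<^sub>R y) ((z - c *\<^sub>R T z) + c *\<^sub>R y) \<le> k * dist x z" for x z
      using contr[of "x - z"] by (simp add: dist_norm blinfun.diff_right algebra_simps)
    then have "\<exists>!x. (x - c *\<^sub>R T x) + c *\<^sub>R y = x"
      by (intro banach_fix_type[OF k(1,2)] allI)
    then obtain x where "(x - c *\<^sub>R T x) + c *\<^sub>R y = x" by (elim ex1E)
    moreover have "c \<noteq> 0" using e M by (simp add: c_def)
    ultimately have "y = T x" by (simp add: algebra_simps)
    then show ?thesis by blast
  qed
  define S where "S y = (SOME x. T x = y)" for y
  have TS: "T (S y) = y" for y unfolding S_def using surj by (rule someI_ex)
  have ST: "S (T x) = x" for x using TS inj by blast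
  have bl: "bounded_linear S"
  proof (rule bounded_linear_intro[where K = "1 / e"])
    show "S (x + y) = S x + S y" for x y
      by (rule inj) (simp add: TS blinfun.add_right)
    show "S (r *\<^sub>R x) = r *\<^sub>R S x" for r x
      by (rule inj) (simp add: TS blinfun.scaleR_right)
    show "norm (S x) \<le> norm x * (1 / e)" for x
      using lower[of "S x"] e by (simp add: TS field_simps)
  qed
  define C where "C = Blinfun S"
  have C: "C x = S x" for x by (simp add: C_def bounded_linear_Blinfun_apply bl)
  have "clinear_op C"
    unfolding clinear_op_def C
    by (intro allI, rule inj) (simp only: TS clinear_opD[OF cl])
  moreover have "T o\<^sub>L C = id_blinfun" "C o\<^sub>L T = id_blinfun"
    by (rule blinfun_eqI, simp add: C TS ST)+
  ultimately show ?thesis unfolding invertible_op_def by blast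
qed

lemma invertible_compose:
  assumes "invertible_op A" "invertible_op B"
  shows "invertible_op (A o\<^sub>L B)"
proof -
  obtain C D where C: "clinear_op C" "A o\<^sub>L C = id_blinfun" "C o\<^sub>L A = id_blinfun"
    and D: "clinear_op D" "B o\<^sub>L D = id_blinfun" "D o\<^sub>L B = id_blinfun"
    using assms by (auto simp: invertible_op_def)
  have "A (C x) = x" "C (A x) = x" "B (D x) = x" "D (B x) = x" for x
    using C(2,3) D(2,3) by (metis blinfun_apply_blinfun_compose blinfun_apply_id_blinfun id_apply)+
  then have "(A o\<^sub>L B) o\<^sub>L (D o\<^sub>L C) = id_blinfun" "(D o\<^sub>L C) o\<^sub>L (A o\<^sub>L B) = id_blinfun"
    by (intro blinfun_eqI; simp)+
  then show ?thesis
    unfolding invertible_op_def using clinear_compose[OF D(1) C(1)] by blast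
qed

lemma invertible_bounded_below:
  assumes "invertible_op A"
  obtains K where "K > 0" "\<And>x. norm x \<le> K * norm (A x)"
proof -
  obtain C where C: "C o\<^sub>L A = id_blinfun" using assms by (auto simp: invertible_op_def)
  \<comment> \<open>The added 1 keeps the constant positive even when C = 0, as on the zero
    space.\<close>
  have "norm x \<le> (norm C + 1) * norm (A x)" for x
  proof -
    have "x = C (A x)" using C by (metis blinfun_apply_blinfun_compose blinfun_apply_id_blinfun id_apply)
    then have "norm x \<le> norm C * norm (A x)" by (metis norm_blinfun)
    then show ?thesis by (simp add: algebra_simps add_increasing)
  qed
  then show ?thesis using that[of "norm C + 1"] by (simp add: add_nonneg_pos)
qed

text \<open>If m^2 - S^2 were bounded below, S would shrink all vectors by a factor uniformly
  smaller than its norm m. The vector z excludes the zero space, where every operator is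
  invertible.\<close>

lemma norm_square_not_invertible:
  fixes S :: "'a::chilbert_space \<Rightarrow>\<^sub>L 'a" and z :: 'a
  assumes sa: "selfadj S" and nz: "z \<noteq> 0"
  shows "\<not> invertible_op ((norm S)\<^sup>2 *\<^sub>R id_blinfun - (S o\<^sub>L S))"
proof
  define m where "m = norm S"
  assume "invertible_op ((norm S)\<^sup>2 *\<^sub>R id_blinfun - (S o\<^sub>L S))"
  then obtain K where K: "K > 0"
      "\<And>x. norm x \<le> K * norm (((norm S)\<^sup>2 *\<^sub>R id_blinfun - (S o\<^sub>L S)) x)"
    using invertible_bounded_below by blast
  have K': "norm x \<le> K * norm (m\<^sup>2 *\<^sub>R x - S (S x))" for x
    using K(2)[of x] by (simp add: blinfun.diff_left blinfun.scaleR_left m_def)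
  have m0: "m \<noteq> 0" using K'[of z] nz by (auto simp: m_def)
  then have m: "m > 0" by (simp add: m_def)
  \<comment> \<open>Combining the lower bound 1/K with the expansion below gives |x|^2 \<le> K^2
    (m^4 |x|^2 - m^2 |S x|^2); dividing by m^2 K^2 leaves exactly this d as the gain over
    m^2.\<close>
  define d where "d = 1 / (m\<^sup>2 * K\<^sup>2)"
  have d: "d > 0" "m\<^sup>2 * K\<^sup>2 * d = 1" using m K by (simp_all add: d_def)
  have le: "(norm (S x))\<^sup>2 \<le> (m\<^sup>2 - d) * (norm x)\<^sup>2" for x
  proof -
    have "(norm (m\<^sup>2 *\<^sub>R x - S (S x)))\<^sup>2
        = m^4 * (norm x)\<^sup>2 - 2 * m\<^sup>2 * inner x (S (S x)) + (norm (S (S x)))\<^sup>2"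
      by (simp only: power2_norm_eq_inner)
        (simp add: inner_diff_left inner_diff_right algebra_simps inner_commute power2_eq_square
          power4_eq_xxxx)
    also have "inner x (S (S x)) = (norm (S x))\<^sup>2"
      by (simp add: power2_norm_eq_inner selfadjD[OF sa])
    also have "(norm (S (S x)))\<^sup>2 \<le> m\<^sup>2 * (norm (S x))\<^sup>2"
      unfolding m_def by (rule norm_blinfun_sq)
    finally have "(norm (m\<^sup>2 *\<^sub>R x - S (S x)))\<^sup>2 \<le> m^4 * (norm x)\<^sup>2 - m\<^sup>2 * (norm (S x))\<^sup>2"
      by (simp add: algebra_simps)
    moreover have "(norm x)\<^sup>2 \<le> K\<^sup>2 * (norm (m\<^sup>2 *\<^sub>R x - S (S x)))\<^sup>2"
      using power_mono[OF K'[of x] norm_ge_zero, of 2] by (simp add: power_mult_distrib)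
    ultimately have "(norm x)\<^sup>2 \<le> K\<^sup>2 * (m^4 * (norm x)\<^sup>2 - m\<^sup>2 * (norm (S x))\<^sup>2)"
      by (meson mult_left_mono order_trans zero_le_power2)
    then have "m\<^sup>2 * K\<^sup>2 * (norm (S x))\<^sup>2 \<le> m\<^sup>2 * K\<^sup>2 * (m\<^sup>2 * (norm x)\<^sup>2) - (norm x)\<^sup>2"
      by (simp add: algebra_simps power4_eq_xxxx power2_eq_square)
    also have "\<dots> = m\<^sup>2 * K\<^sup>2 * (m\<^sup>2 * (norm x)\<^sup>2) - (m\<^sup>2 * K\<^sup>2 * d) * (norm x)\<^sup>2"
      by (simp only: d(2) mult_1)
    also have "\<dots> = m\<^sup>2 * K\<^sup>2 * ((m\<^sup>2 - d) * (norm x)\<^sup>2)"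
      by (simp only: algebra_simps)
    finally have "m\<^sup>2 * K\<^sup>2 * (norm (S x))\<^sup>2 \<le> m\<^sup>2 * K\<^sup>2 * ((m\<^sup>2 - d) * (norm x)\<^sup>2)" .
    moreover have "0 < m\<^sup>2 * K\<^sup>2" using m K by simp
    ultimately show ?thesis by (rule mult_left_le_imp_le)
  qed
  have d': "0 \<le> m\<^sup>2 - d"
  proof (rule ccontr)
    assume "\<not> 0 \<le> m\<^sup>2 - d"
    then have "(m\<^sup>2 - d) * (norm z)\<^sup>2 < 0" using nz by (simp add: mult_neg_pos)
    with le[of z] show False by (smt (verit) zero_le_power2)
  qed
  have "norm S \<le> sqrt (m\<^sup>2 - d)"
  proof (rule norm_blinfun_bound)
    show "norm (S x) \<le> sqrt (m\<^sup>2 - d) * norm x" for x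
      using le[of x] d' by (auto intro!: power2_le_imp_le[of "norm (S x)"] simp: power_mult_distrib)
  qed (use d' in simp)
  then have "m\<^sup>2 \<le> m\<^sup>2 - d"
    using power_mono[of m "sqrt (m\<^sup>2 - d)" 2] m d' by (simp flip: m_def)
  then show False using d by simp
qed


section \<open>Functional calculus\<close>

lemma poly_op_atMost:
  assumes "degree p \<le> n"
  shows "poly_op p A = (\<Sum>i\<le>n. coeff p i *\<^sub>R (((o\<^sub>L) A ^^ i) id_blinfun))"
  unfolding poly_op_def
  by (rule sum.mono_neutral_left) (use assms in \<open>auto simp: coeff_eq_0\<close>)

lemma poly_op_0 [simp]: "poly_op 0 A = 0"
  by (simp add: poly_op_def)

text \<open>The Horner recursion; with it the algebra of \<open>poly_op\<close> follows by induction
  on polynomials without handling the sum.\<close>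

lemma poly_op_pCons: "poly_op (pCons c p) A = c *\<^sub>R id_blinfun + (A o\<^sub>L poly_op p A)"
proof -
  have "poly_op (pCons c p) A
      = (\<Sum>i\<le>Suc (degree p). coeff (pCons c p) i *\<^sub>R (((o\<^sub>L) A ^^ i) id_blinfun))"
    by (rule poly_op_atMost) (rule degree_pCons_le)
  also have "\<dots> = c *\<^sub>R id_blinfun
      + (\<Sum>i\<le>degree p. coeff p i *\<^sub>R (A o\<^sub>L ((o\<^sub>L) A ^^ i) id_blinfun))"
    by (simp add: sum.atMost_Suc_shift del: sum.atMost_Suc)
  also have "(\<Sum>i\<le>degree p. coeff p i *\<^sub>R (A o\<^sub>L ((o\<^sub>L) A ^^ i) id_blinfun)) = (A o\<^sub>L poly_op p A)"
    unfolding poly_op_def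
    by (rule blinfun_eqI) (simp add: blinfun.sum_left blinfun.scaleR_left blinfun.sum_right blinfun.scaleR_right)
  finally show ?thesis .
qed

lemma poly_op_add: "poly_op (p + q) A = poly_op p A + poly_op q A"
proof (induction p arbitrary: q)
  case (pCons c p)
  obtain d r where "q = pCons d r" by (cases q)
  then show ?case
    by (auto intro!: blinfun_eqI simp: poly_op_pCons pCons.IH blinfun.add_left blinfun.add_right
        blinfun.scaleR_left scaleR_add_left)
qed simp

lemma poly_op_smult: "poly_op (smult r p) A = r *\<^sub>R poly_op p A"
  by (induction p)
    (auto intro!: blinfun_eqI simp: poly_op_pCons blinfun.add_left blinfun.add_right
        blinfun.scaleR_left blinfun.scaleR_right scaleR_add_right)

lemma poly_op_mult: "poly_op (p * q) A = poly_op p A o\<^sub>L poly_op q A"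
  by (induction p)
    (auto intro!: blinfun_eqI simp: poly_op_pCons poly_op_add poly_op_smult blinfun.add_left blinfun.add_right
        blinfun.scaleR_left blinfun.scaleR_right)

lemma poly_op_diff: "poly_op (p - q) A = poly_op p A - poly_op q A"
  using poly_op_add[of p "- q" A] poly_op_smult[of "- 1" q A] by simp

lemma poly_op_const: "poly_op [:c:] A = c *\<^sub>R id_blinfun"
  by (simp add: poly_op_pCons)

lemma poly_op_X: "poly_op [:0, 1:] A = A"
  by (rule blinfun_eqI) (simp add: poly_op_pCons blinfun.add_left)

lemma poly_op_pcompose: "poly_op (pcompose p q) A = poly_op p (poly_op q A)"
  by (induction p) (simp_all add: pcompose_pCons poly_op_pCons poly_op_add poly_op_mult)

lemma poly_op_commute: "A (poly_op p A x) = poly_op p A (A x)"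
  by (induction p arbitrary: x)
    (simp_all add: poly_op_pCons blinfun.add_left blinfun.add_right blinfun.scaleR_left blinfun.scaleR_right)

lemma selfadj_poly_op: "selfadj A \<Longrightarrow> selfadj (poly_op p A)"
proof (induction p)
  case (pCons c p)
  then have IH: "selfadj (poly_op p A)" by blast
  have "selfadj (A o\<^sub>L poly_op p A)"
    using pCons.prems IH by (auto simp: selfadj_def poly_op_commute intro: clinear_intros)
  then show ?case
    unfolding poly_op_pCons by (intro selfadj_add selfadj_scaleR selfadj_id)
qed (simp add: selfadj_zero)

text \<open>A real polynomial factors into real linear factors and factors \<open>(X - a)\<^sup>2 + b\<^sup>2\<close>; at a
  self-adjoint operator the latter are bounded below by \<open>b\<^sup>2\<close>, hence invertible.\<close>

lemma real_poly_cases: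
  fixes q :: "real poly"
  assumes "degree q > 0"
  obtains (linear) r s where "q = [:-r, 1:] * s"
    | (quadratic) a b s where "b \<noteq> 0" "q = ([:-a, 1:] * [:-a, 1:] + [:b\<^sup>2:]) * s"
proof -
  define cp where "cp p = map_poly complex_of_real p" for p
  have cp_0: "cp 0 = 0" and cp_pCons: "cp (pCons c p) = pCons (complex_of_real c) (cp p)" for c p
    by (simp_all add: cp_def map_poly_pCons)
  have cp_add: "poly (cp (p + p')) z = poly (cp p) z + poly (cp p') z" for p p' z
  proof -
    have "cp (p + p') = cp p + cp p'" by (rule poly_eqI) (simp add: cp_def coeff_map_poly)
    then show ?thesis by simp
  qed
  have cp_mult: "poly (cp (p * p')) z = poly (cp p) z * poly (cp p') z" for p p' z
  proof -
    have "cp (smult c p') = smult (complex_of_real c) (cp p')" for c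
      by (rule poly_eqI) (simp add: cp_def coeff_map_poly)
    then show ?thesis
      by (induction p) (simp_all add: cp_0 cp_pCons cp_add algebra_simps)
  qed
  have "degree (cp q) > 0" using assms by (simp add: cp_def degree_map_poly)
  then have "\<not> constant (poly (cp q))" by (simp add: constant_degree)
  then obtain z where z: "poly (cp q) z = 0" using fundamental_theorem_of_algebra by blast
  define a b where "a = Re z" and "b = Im z"
  have zab: "z = Complex a b" by (simp add: a_def b_def)
  show ?thesis
  proof (cases "b = 0")
    case True
    then have "z = complex_of_real a" by (simp add: zab complex_eq_iff)
    moreover have "poly (cp p) (complex_of_real a) = complex_of_real (poly p a)" for p
      by (induction p) (simp_all add: cp_0 cp_pCons)
    ultimately have "complex_of_real (poly q a) = 0" using z by simp
    then have "poly q a = 0" by simp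
    then have "[:-a, 1:] dvd q" by (simp add: poly_eq_0_iff_dvd)
    then show ?thesis using linear by (auto elim: dvdE)
  next
    case False
    define s where "s = [:-a, 1:] * [:-a, 1:] + [:b\<^sup>2:]"
    have s_eq: "s = [:a\<^sup>2 + b\<^sup>2, - 2 * a, 1:]" by (simp add: s_def power2_eq_square)
    then have "degree s = 2" "s \<noteq> 0" by auto
    \<comment> \<open>The quadratic s is the real polynomial with roots z and its conjugate. The
      remainder is linear with real coefficients and vanishes at the non-real z, so it is zero and s
      divides q.\<close>
    define r where "r = q mod s"
    have "r = 0 \<or> degree r < 2" unfolding r_def using degree_mod_less[of s q] \<open>degree s = 2\<close> \<open>s \<noteq> 0\<close> by simp
    then obtain r0 r1 where r: "r = [:r0, r1:]"
      by (metis degree_eq_zeroE degree_pCons_eq_if less_2_cases_iff not_less_eq pCons_0_0 pCons_cases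
          numeral_2_eq_2 less_Suc0)
    have "poly (cp s) z = 0"
      by (simp add: s_eq cp_pCons cp_0 zab complex_eq_iff algebra_simps power2_eq_square)
    moreover have "q = q div s * s + r" by (simp add: r_def)
    ultimately have "poly (cp r) z = 0"
      using z by (metis cp_add cp_mult mult_zero_right add_0)
    then have "r1 * b = 0" "r0 + r1 * a = 0"
      by (simp_all add: r cp_pCons cp_0 zab complex_eq_iff algebra_simps)
    then have "r = 0" using False by (simp add: r)
    then have "q = s * (q div s)" using \<open>q = q div s * s + r\<close> by (simp add: mult.commute)
    then show ?thesis using quadratic False unfolding s_def by blast
  qed
qed

text \<open>Induction on the degree: a linear factor X - r has its root outside the spectrum, a
  quadratic factor is coercive, and products of invertible operators are invertible.\<close>

lemma poly_op_invertible:
  fixes A :: "'a::chilbert_space \<Rightarrow>\<^sub>L 'a"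
  assumes sa: "selfadj A" and "q \<noteq> 0"
    and "\<And>x. complex_of_real x \<in> op_spectrum A \<Longrightarrow> poly q x \<noteq> 0"
  shows "invertible_op (poly_op q A)"
  using assms(2,3)
proof (induction "degree q" arbitrary: q rule: less_induct)
  case less
  show ?case
  proof (cases "degree q = 0")
    case True
    then obtain c where q: "q = [:c:]" by (metis degree_eq_zeroE)
    then have "c \<noteq> 0" using less.prems by simp
    then show ?thesis unfolding invertible_op_def q poly_op_const
      by (intro exI[of _ "(1/c) *\<^sub>R id_blinfun"] conjI clinear_intros blinfun_eqI)
        (simp_all add: blinfun.scaleR_left blinfun.scaleR_right)
  next
    case False
    then have "degree q > 0" by simp
    then show ?thesis
    proof (cases rule: real_poly_cases)
      case (linear r s)
      have "s \<noteq> 0" using linear less.prems by auto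
      then have "invertible_op (poly_op s A)"
        using linear less.prems degree_mult_eq[of "[:-r, 1:]" s]
        by (intro less.hyps) (auto simp del: mult_pCons_left)
      moreover have "complex_of_real r \<notin> op_spectrum A"
        using less.prems(2)[of r] linear by auto
      then have "invertible_op (A - scalar_op (complex_of_real r))"
        by (simp add: op_spectrum_def)
      moreover have "A - scalar_op (complex_of_real r) = poly_op [:-r, 1:] A"
        by (rule blinfun_eqI)
          (simp add: poly_op_pCons blinfun.add_left blinfun.diff_left blinfun.scaleR_left
            blinfun.minus_left scaleC_of_real)
      ultimately show ?thesis
        unfolding linear poly_op_mult by (simp add: invertible_compose)
    next
      case (quadratic a b s)
      let ?L = "[:-a, 1:]"
      have "s \<noteq> 0" using quadratic less.prems by auto
      moreover have "?L * ?L + [:b\<^sup>2:] = [:a\<^sup>2 + b\<^sup>2, - 2 * a, 1:]" by (simp add: power2_eq_square)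
      ultimately have "degree s < degree q" unfolding quadratic
        by (subst degree_mult_eq) auto
      then have "invertible_op (poly_op s A)"
        using quadratic less.prems \<open>s \<noteq> 0\<close>
        by (intro less.hyps) (auto simp del: mult_pCons_left)
      moreover have "invertible_op (poly_op (?L * ?L + [:b\<^sup>2:]) A)"
      proof (rule coercive_invertible[where e = "b\<^sup>2"])
        show "clinear_op (poly_op (?L * ?L + [:b\<^sup>2:]) A)"
          by (intro selfadj_clinear selfadj_poly_op sa)
        show "0 < b\<^sup>2" using quadratic by simp
        fix x
        have "inner x (poly_op (?L * ?L + [:b\<^sup>2:]) A x)
            = inner (poly_op ?L A x) (poly_op ?L A x) + b\<^sup>2 * inner x x"
          using selfadjD[OF selfadj_poly_op[OF sa], of ?L x "poly_op ?L A x"]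
          by (simp only: poly_op_add poly_op_mult poly_op_const blinfun.add_left blinfun.scaleR_left
              inner_add_right inner_scaleR_right blinfun_apply_blinfun_compose blinfun_apply_id_blinfun id_apply)
        then show "b\<^sup>2 * (norm x)\<^sup>2 \<le> inner x (poly_op (?L * ?L + [:b\<^sup>2:]) A x)"
          by (simp add: power2_norm_eq_inner)
      qed
      ultimately show ?thesis
        unfolding quadratic poly_op_mult by (simp add: invertible_compose)
    qed
  qed
qed

text \<open>If p(A) had norm m > M, then m^2 - p^2 would have no zero on the spectrum, making m^2 -
  p(A)^2 invertible against \<open>norm_square_not_invertible\<close>.\<close>

lemma norm_poly_op_le:
  fixes A :: "'a::chilbert_space \<Rightarrow>\<^sub>L 'a"
  assumes sa: "selfadj A" and M: "0 \<le> M"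
    and le: "\<And>x. complex_of_real x \<in> op_spectrum A \<Longrightarrow> \<bar>poly p x\<bar> \<le> M"
  shows "norm (poly_op p A) \<le> M"
proof (rule ccontr)
  assume "\<not> norm (poly_op p A) \<le> M"
  then have less: "M < norm (poly_op p A)" by simp
  then have "poly_op p A \<noteq> 0" using M by auto
  then obtain z :: 'a where z: "z \<noteq> 0" by (metis blinfun_eqI zero_blinfun.rep_eq blinfun.zero_right)
  define square_gap where "square_gap q = [:(norm (poly_op q A))\<^sup>2:] - q * q" for q
  have "poly_op (square_gap q) A = (norm (poly_op q A))\<^sup>2 *\<^sub>R id_blinfun - (poly_op q A o\<^sub>L poly_op q A)" for q
    by (simp add: square_gap_def poly_op_diff poly_op_mult poly_op_const)
  then have root: "\<exists>x. complex_of_real x \<in> op_spectrum A \<and> poly (square_gap q) x = 0"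
    if "square_gap q \<noteq> 0" for q
    using norm_square_not_invertible[OF selfadj_poly_op[OF sa] z, of q]
      poly_op_invertible[OF sa that] by auto
  \<comment> \<open>For p = X the gap polynomial is certainly nonzero, so the real spectrum has a
    point x0. Nonvanishing at x0 then shows that \<open>square_gap p\<close> is not the zero
    polynomial.\<close>
  have "square_gap [:0, 1:] \<noteq> 0" by (simp add: square_gap_def)
  then obtain x0 where "complex_of_real x0 \<in> op_spectrum A" using root by blast
  moreover have "poly (square_gap p) x \<noteq> 0" if "complex_of_real x \<in> op_spectrum A" for x
  proof
    assume "poly (square_gap p) x = 0"
    then have "\<bar>poly p x\<bar> = norm (poly_op p A)"
      by (simp add: square_gap_def power2_eq_square[symmetric] power2_eq_iff_nonneg flip: abs_eq_iff)
        (metis abs_norm_cancel power2_eq_iff abs_eq_iff)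
    then show False using le[OF that] less by simp
  qed
  ultimately show False using root[of p] by fastforce
qed

text \<open>For x below a the operator A - x is coercive, and for x above b its negative is.\<close>

lemma between_spectrum:
  fixes A :: "'a::chilbert_space \<Rightarrow>\<^sub>L 'a"
  assumes A: "between_op a b A" and x: "complex_of_real x \<in> op_spectrum A"
  shows "x \<in> {a..b}"
proof (rule ccontr)
  let ?T = "A - scalar_op (complex_of_real x)"
  have T: "?T = A - x *\<^sub>R id_blinfun"
    by (rule blinfun_eqI) (simp add: blinfun.diff_left blinfun.scaleR_left scaleC_of_real)
  have sa: "selfadj ?T" unfolding T
    by (intro selfadj_diff selfadj_scaleR selfadj_id between_op_selfadj[OF A])
  have inner_T: "inner y (?T y) = inner y (A y) - x * (norm y)\<^sup>2" for y
    unfolding T by (simp add: blinfun.diff_left blinfun.scaleR_left inner_diff_right power2_norm_eq_inner)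
  assume "x \<notin> {a..b}"
  then consider "x < a" | "b < x" by fastforce
  then have "invertible_op ?T"
  proof cases
    case 1
    show ?thesis
    proof (rule coercive_invertible[where e = "a - x"])
      show "(a - x) * (norm y)\<^sup>2 \<le> inner y (?T y)" for y
        using between_op_lower[OF A, of y] by (simp add: inner_T algebra_simps)
    qed (use sa 1 in \<open>auto simp: selfadj_def\<close>)
  next
    case 2
    have "invertible_op ((-1) *\<^sub>R ?T)"
    proof (rule coercive_invertible[where e = "x - b"])
      show "(x - b) * (norm y)\<^sup>2 \<le> inner y (((-1) *\<^sub>R ?T) y)" for y
        using between_op_upper[OF A, of y] inner_T[of y]
        by (simp only: blinfun.scaleR_left inner_scaleR_right) (simp add: algebra_simps)
      show "clinear_op ((-1) *\<^sub>R ?T)" by (intro clinear_scaleR selfadj_clinear[OF sa])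
    qed (use 2 in simp)
    moreover have "invertible_op ((-1) *\<^sub>R id_blinfun :: 'a \<Rightarrow>\<^sub>L 'a)"
      unfolding invertible_op_def
      by (intro exI[of _ "(-1) *\<^sub>R id_blinfun"] conjI clinear_intros blinfun_eqI)
        (simp_all add: blinfun.scaleR_left blinfun.minus_left blinfun.minus_right)
    ultimately have "invertible_op (((-1) *\<^sub>R id_blinfun) o\<^sub>L ((-1) *\<^sub>R ?T))" by (rule invertible_compose[rotated])
    moreover have "((-1) *\<^sub>R id_blinfun) o\<^sub>L ((-1) *\<^sub>R ?T) = ?T"
      by (rule blinfun_eqI) (simp add: blinfun.scaleR_left blinfun.minus_left blinfun.diff_left)
    ultimately show ?thesis by (simp only:)
  qed
  then show False using x by (simp add: op_spectrum_def)
qed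

lemma norm_poly_op_between:
  assumes "between_op a b A" and "0 \<le> M" and "\<And>x. x \<in> {a..b} \<Longrightarrow> \<bar>poly p x\<bar> \<le> M"
  shows "norm (poly_op p A) \<le> M"
  using norm_poly_op_le[OF between_op_selfadj[OF assms(1)] assms(2)] between_spectrum[OF assms(1)] assms(3)
  by blast

section \<open>Continuous functions of a self-adjoint operator\<close>

lemma poly_approx:
  fixes f :: "real \<Rightarrow> real"
  assumes "continuous_on {a..b} f"
  obtains p where "uniform_limit {a..b} (\<lambda>n. poly (p n)) f sequentially"
proof -
  have "\<exists>p. \<forall>x\<in>{a..b}. \<bar>f x - poly p x\<bar> < 1 / real (Suc n)" for n
  proof -
    obtain g where g: "real_polynomial_function g" "\<And>x. x \<in> {a..b} \<Longrightarrow> \<bar>f x - g x\<bar> < 1 / real (Suc n)"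
      using Stone_Weierstrass_real_polynomial_function[OF compact_Icc assms, of "1 / real (Suc n)"] by auto
    then obtain c m where "g = (\<lambda>x. \<Sum>i\<le>m. c i * x ^ i)"
      by (auto simp: real_polynomial_function_iff_sum)
    then have "poly (\<Sum>i\<le>m. monom (c i) i) x = g x" for x
      by (simp add: poly_sum poly_monom)
    then show ?thesis using g(2) by metis
  qed
  then obtain p where p: "\<And>n x. x \<in> {a..b} \<Longrightarrow> \<bar>f x - poly (p n) x\<bar> < 1 / real (Suc n)"
    by metis
  have "uniform_limit {a..b} (\<lambda>n. poly (p n)) f sequentially"
  proof (rule uniform_limitI)
    fix e :: real assume "0 < e"
    then have "\<forall>\<^sub>F n in sequentially. 1 / real (Suc n) < e"
      using LIMSEQ_inverse_real_of_nat by (auto simp: order_tendsto_iff inverse_eq_divide)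
    then show "\<forall>\<^sub>F n in sequentially. \<forall>x\<in>{a..b}. dist (poly (p n) x) (f x) < e"
    proof eventually_elim
      case (elim n)
      show ?case using p[of _ n] elim by (force simp: dist_real_def abs_minus_commute)
    qed
  qed
  then show ?thesis by (rule that)
qed

text \<open>Independence of the approximating sequence. Convergence is assumed on the spectrum only,
  because that is all the sequences in \<open>fun_calc\<close> provide.\<close>

lemma poly_op_uniform_limit_zero:
  assumes sa: "selfadj A"
    and lim: "uniform_limit {x. complex_of_real x \<in> op_spectrum A} (\<lambda>n x. poly (p n) x - poly (q n) x) (\<lambda>_. 0) sequentially"
  shows "(\<lambda>n. poly_op (p n) A - poly_op (q n) A) \<longlonglongrightarrow> 0"
proof (rule tendstoI)
  fix e :: real assume "0 < e"
  then have "\<forall>\<^sub>F n in sequentially. \<forall>x\<in>{x. complex_of_real x \<in> op_spectrum A}.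
      dist (poly (p n) x - poly (q n) x) 0 < e / 2"
    using lim by (intro uniform_limitD) auto
  then show "\<forall>\<^sub>F n in sequentially. dist (poly_op (p n) A - poly_op (q n) A) 0 < e"
  proof eventually_elim
    case (elim n)
    have "norm (poly_op (p n - q n) A) \<le> e / 2"
      using elim \<open>0 < e\<close> by (intro norm_poly_op_le[OF sa]) (auto intro: less_imp_le)
    then show ?case using \<open>0 < e\<close> by (simp add: poly_op_diff)
  qed
qed

lemma poly_op_uniform_limit_Cauchy:
  assumes A: "between_op a b A" and lim: "uniform_limit {a..b} (\<lambda>n. poly (p n)) f sequentially"
  shows "Cauchy (\<lambda>n. poly_op (p n) A)"
proof (rule metric_CauchyI)
  fix e :: real assume "0 < e"
  then have "\<forall>\<^sub>F n in sequentially. \<forall>x\<in>{a..b}. dist (poly (p n) x) (f x) < e / 4"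
    using lim by (intro uniform_limitD) auto
  then obtain N where N: "\<And>n x. n \<ge> N \<Longrightarrow> x \<in> {a..b} \<Longrightarrow> dist (poly (p n) x) (f x) < e / 4"
    unfolding eventually_sequentially by blast
  have "dist (poly_op (p m) A) (poly_op (p n) A) < e" if "m \<ge> N" "n \<ge> N" for m n
  proof -
    have "norm (poly_op (p m - p n) A) \<le> e / 2"
    proof (rule norm_poly_op_between[OF A])
      show "\<bar>poly (p m - p n) x\<bar> \<le> e / 2" if "x \<in> {a..b}" for x
        using N[OF \<open>m \<ge> N\<close> that] N[OF \<open>n \<ge> N\<close> that] unfolding dist_real_def poly_diff by linarith
    qed (use \<open>0 < e\<close> in simp)
    then show ?thesis using \<open>0 < e\<close> by (simp add: dist_norm poly_op_diff)
  qed
  then show "\<exists>M. \<forall>m\<ge>M. \<forall>n\<ge>M. dist (poly_op (p m) A) (poly_op (p n) A) < e" by blast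
qed

text \<open>A single sequence converging on the interval determines the description in
  \<open>fun_calc\<close>: any competing sequence has the same operator limit, and a competing limit
  is refuted by the given sequence.\<close>

lemma fun_calc_eqI:
  assumes A: "between_op a b A" and lim: "uniform_limit {a..b} (\<lambda>n. poly (p n)) f sequentially"
    and C: "(\<lambda>n. poly_op (p n) A) \<longlonglongrightarrow> C"
  shows "fun_calc f A = C"
  unfolding fun_calc_def
proof (rule the_equality, intro allI impI)
  have lim': "uniform_limit {x. complex_of_real x \<in> op_spectrum A} (\<lambda>n. poly (p n)) f sequentially"
    using between_spectrum[OF A] by (intro uniform_limit_on_subset[OF lim]) auto
  show "(\<lambda>n. poly_op (q n) A) \<longlonglongrightarrow> C"
    if q: "uniform_limit {x. complex_of_real x \<in> op_spectrum A} (\<lambda>n. poly (q n)) f sequentially" for q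
  proof -
    have "(\<lambda>n. poly_op (q n) A - poly_op (p n) A) \<longlonglongrightarrow> 0"
      using uniform_limit_minus[OF q lim'] by (intro poly_op_uniform_limit_zero[OF between_op_selfadj[OF A]]) simp
    from tendsto_add[OF this C] show ?thesis by simp
  qed
  show "D = C" if "\<forall>q. uniform_limit {x. complex_of_real x \<in> op_spectrum A} (\<lambda>n. poly (q n)) f sequentially
      \<longrightarrow> (\<lambda>n. poly_op (q n) A) \<longlonglongrightarrow> D" for D
    using that lim' C LIMSEQ_unique by blast
qed

lemma fun_calc_lim:
  assumes A: "between_op a b A" and lim: "uniform_limit {a..b} (\<lambda>n. poly (p n)) f sequentially"
  shows "(\<lambda>n. poly_op (p n) A) \<longlonglongrightarrow> fun_calc f A"
  using poly_op_uniform_limit_Cauchy[OF assms] fun_calc_eqI[OF assms]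
  by (metis Cauchy_convergent convergent_def)

lemma bounded_linear_blinfun_apply: "bounded_linear (\<lambda>A. blinfun_apply A x)"
  by (rule blinfun.bounded_linear_left)

lemma tendsto_blinfun_apply: "(X \<longlongrightarrow> A) F \<Longrightarrow> ((\<lambda>n. blinfun_apply (X n) x) \<longlongrightarrow> A x) F"
  by (rule bounded_linear.tendsto[OF bounded_linear_blinfun_apply])

lemma selfadj_lim:
  assumes X: "X \<longlonglongrightarrow> A" and sa: "\<And>n. selfadj (X n)"
  shows "selfadj A"
  unfolding selfadj_def clinear_op_def
proof (intro conjI allI)
  fix c x y
  have "(\<lambda>n. c *\<^sub>C X n x) \<longlonglongrightarrow> c *\<^sub>C A x"
    by (intro bounded_linear.tendsto[OF bounded_linear_scaleC] tendsto_blinfun_apply X)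
  moreover have "(\<lambda>n. X n (c *\<^sub>C x)) \<longlonglongrightarrow> A (c *\<^sub>C x)"
    by (intro tendsto_blinfun_apply X)
  ultimately show "A (c *\<^sub>C x) = c *\<^sub>C A x"
    using sa by (metis (no_types, lifting) LIMSEQ_unique clinear_opD selfadj_clinear ext)
  have "(\<lambda>n. inner (X n x) y) \<longlonglongrightarrow> inner (A x) y" "(\<lambda>n. inner x (X n y)) \<longlonglongrightarrow> inner x (A y)"
    by (intro tendsto_intros tendsto_blinfun_apply X)+
  moreover have "inner (X n x) y = inner x (X n y)" for n by (rule selfadjD[OF sa])
  ultimately show "inner (A x) y = inner x (A y)" using LIMSEQ_unique by simp
qed

lemma selfadj_fun_calc:
  assumes A: "between_op a b A" and f: "continuous_on {a..b} f"
  shows "selfadj (fun_calc f A)"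
proof -
  obtain p where "uniform_limit {a..b} (\<lambda>n. poly (p n)) f sequentially" using poly_approx[OF f] .
  from selfadj_lim[OF fun_calc_lim[OF A this] selfadj_poly_op[OF between_op_selfadj[OF A]]] show ?thesis .
qed

text \<open>The polynomial estimate passed to the limit with slack e. It serves for equality of
  functions (M = 0), for order bounds and for continuity in the exponent.\<close>

lemma norm_fun_calc_diff_le:
  assumes A: "between_op a b A" and f: "continuous_on {a..b} f" and g: "continuous_on {a..b} g"
    and M: "0 \<le> M" "\<And>x. x \<in> {a..b} \<Longrightarrow> \<bar>f x - g x\<bar> \<le> M"
  shows "norm (fun_calc f A - fun_calc g A) \<le> M"
proof -
  obtain p q where p: "uniform_limit {a..b} (\<lambda>n. poly (p n)) f sequentially"
    and q: "uniform_limit {a..b} (\<lambda>n. poly (q n)) g sequentially"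
    using poly_approx f g by metis
  have pq: "uniform_limit {a..b} (\<lambda>n x. poly (p n) x - poly (q n) x) (\<lambda>x. f x - g x) sequentially"
    by (rule uniform_limit_minus[OF p q])
  have "norm (fun_calc f A - fun_calc g A) \<le> M + e" if "0 < e" for e
  proof (rule tendsto_upperbound)
    show "(\<lambda>n. norm (poly_op (p n) A - poly_op (q n) A)) \<longlonglongrightarrow> norm (fun_calc f A - fun_calc g A)"
      by (intro tendsto_intros fun_calc_lim[OF A] p q)
    have "\<forall>\<^sub>F n in sequentially. \<forall>x\<in>{a..b}. dist (poly (p n) x - poly (q n) x) (f x - g x) < e"
      using pq \<open>0 < e\<close> by (rule uniform_limitD)
    then show "\<forall>\<^sub>F n in sequentially. norm (poly_op (p n) A - poly_op (q n) A) \<le> M + e"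
    proof eventually_elim
      case (elim n)
      have "norm (poly_op (p n - q n) A) \<le> M + e"
      proof (rule norm_poly_op_between[OF A])
        show "\<bar>poly (p n - q n) x\<bar> \<le> M + e" if "x \<in> {a..b}" for x
          using bspec[OF elim that] M(2)[OF that] unfolding dist_real_def poly_diff by linarith
      qed (use M \<open>0 < e\<close> in simp)
      then show ?case by (simp add: poly_op_diff)
    qed
  qed simp
  then show ?thesis by (rule field_le_epsilon)
qed

lemma fun_calc_cong:
  assumes "between_op a b A" "continuous_on {a..b} f" "continuous_on {a..b} g"
    and "\<And>x. x \<in> {a..b} \<Longrightarrow> f x = g x"
  shows "fun_calc f A = fun_calc g A"
  using norm_fun_calc_diff_le[OF assms(1-3), of 0] assms(4) by simp

lemma fun_calc_poly:
  assumes "between_op a b A"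
  shows "fun_calc (poly p) A = poly_op p A"
  by (rule fun_calc_eqI[OF assms, of "\<lambda>_. p"]) (auto simp: uniform_limit_const)

lemma fun_calc_mult:
  assumes A: "between_op a b A" and f: "continuous_on {a..b} f" and g: "continuous_on {a..b} g"
  shows "fun_calc (\<lambda>x. f x * g x) A = fun_calc f A o\<^sub>L fun_calc g A"
proof -
  obtain p q where p: "uniform_limit {a..b} (\<lambda>n. poly (p n)) f sequentially"
    and q: "uniform_limit {a..b} (\<lambda>n. poly (q n)) g sequentially"
    using poly_approx f g by metis
  show ?thesis
  proof (rule fun_calc_eqI[OF A, of "\<lambda>n. p n * q n"])
    have "uniform_limit {a..b} (\<lambda>n x. poly (p n) x * poly (q n) x) (\<lambda>x. f x * g x) sequentially"
      using f g by (intro uniform_lim_mult p q compact_imp_bounded compact_continuous_image) auto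
    then show "uniform_limit {a..b} (\<lambda>n. poly (p n * q n)) (\<lambda>x. f x * g x) sequentially"
      by (simp add: poly_mult[abs_def])
    show "(\<lambda>n. poly_op (p n * q n) A) \<longlonglongrightarrow> (fun_calc f A o\<^sub>L fun_calc g A)"
      unfolding poly_op_mult
      by (intro bounded_bilinear.tendsto[OF bounded_bilinear_blinfun_compose] fun_calc_lim[OF A] p q)
  qed
qed

text \<open>Both f - m and f - M are at most M - m in modulus. Comparing f(A) with the constant m
  gives the upper bound of the quadratic form, comparing it with M the lower one.\<close>

lemma fun_calc_bounds:
  assumes A: "between_op a b A" and f: "continuous_on {a..b} f"
    and m: "\<And>x. x \<in> {a..b} \<Longrightarrow> m \<le> f x \<and> f x \<le> M"
  shows "between_op m M (fun_calc f A)"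
proof -
  have sa: "selfadj (fun_calc f A)" by (rule selfadj_fun_calc[OF A f])
  show ?thesis
  proof (cases "m \<le> M")
    case mM: True
    have *: "\<bar>inner x (fun_calc f A x) - c * (norm x)\<^sup>2\<bar> \<le> (M - m) * (norm x)\<^sup>2"
      if "c = m \<or> c = M" for c x
    proof -
      let ?D = "fun_calc f A - c *\<^sub>R id_blinfun"
      have "norm (fun_calc f A - fun_calc (poly [:c:]) A) \<le> M - m"
        using mM m that by (intro norm_fun_calc_diff_le[OF A f]) (fastforce intro!: continuous_intros)+
      then have D: "norm ?D \<le> M - m" by (simp add: fun_calc_poly[OF A] poly_op_const)
      have "\<bar>inner x (?D x)\<bar> \<le> norm x * norm (?D x)" by (rule Cauchy_Schwarz_ineq2)
      also have "\<dots> \<le> norm x * ((M - m) * norm x)"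
        using norm_blinfun[of ?D x] mult_right_mono[OF D norm_ge_zero[of x]]
        by (intro mult_left_mono) (auto intro: order_trans)
      finally show ?thesis
        by (simp add: blinfun.diff_left blinfun.scaleR_left inner_diff_right power2_norm_eq_inner
            power2_eq_square mult_ac flip: power2_norm_eq_inner)
    qed
    have "m * (norm x)\<^sup>2 \<le> inner x (fun_calc f A x) \<and> inner x (fun_calc f A x) \<le> M * (norm x)\<^sup>2" for x
      using *[of m x] *[of M x] unfolding left_diff_distrib by linarith
    then show ?thesis using sa by (simp add: between_op_def)
  next
    case False
    \<comment> \<open>A point of the interval would force m \<le> M. With b < a the bounds on A
      leave only the zero vector.\<close>
    then have "{a..b} = {}" using m by force
    then have zero: "norm x = 0" for x :: 'a
      using between_op_lower[OF A, of x] between_op_upper[OF A, of x]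
      by (smt (verit) atLeastatMost_empty_iff mult_le_cancel_right zero_le_power2 power2_eq_square mult_eq_0_iff)
    then have "inner x y = 0" for x y :: 'a by (metis inner_zero_left norm_eq_zero)
    then show ?thesis using sa unfolding between_op_def zero by simp
  qed
qed


lemma fun_calc_id:
  assumes "between_op a b A"
  shows "fun_calc (\<lambda>x. x) A = A"
proof -
  have "poly [:0, 1:] = (\<lambda>x::real. x)" by (rule ext) simp
  then show ?thesis using fun_calc_poly[OF assms, of "[:0, 1:]"] by (simp only: poly_op_X)
qed

section \<open>Positive square roots and their uniqueness\<close>

lemma inner_square: "selfadj R \<Longrightarrow> inner x (R (R x)) = (norm (R x))\<^sup>2"
  by (simp add: power2_norm_eq_inner selfadjD)

lemma positive_square: "selfadj R \<Longrightarrow> positive_op (R o\<^sub>L R)"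
  by (simp add: positive_op_iff selfadj_square inner_square)

lemma positive_sqrt:
  assumes "positive_op A"
  shows "selfadj (fun_calc sqrt A)" and "fun_calc sqrt A o\<^sub>L fun_calc sqrt A = A"
proof -
  have A: "between_op 0 (norm A) A" by (rule positive_between[OF assms])
  have cont: "continuous_on {0..norm A} sqrt" by (intro continuous_intros)
  show "selfadj (fun_calc sqrt A)" by (rule selfadj_fun_calc[OF A cont])
  have "fun_calc sqrt A o\<^sub>L fun_calc sqrt A = fun_calc (\<lambda>x. sqrt x * sqrt x) A"
    by (rule fun_calc_mult[OF A cont cont, symmetric])
  also have "\<dots> = fun_calc (\<lambda>x. x) A"
    by (rule fun_calc_cong[OF A]) (auto intro!: continuous_intros)
  finally show "fun_calc sqrt A o\<^sub>L fun_calc sqrt A = A" by (simp add: fun_calc_id[OF A])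
qed

text \<open>If p_n approximates the root on [0, M^2], then p_n(x^2) approximates sqrt(x^2) = x on
  [0, M], and p_n(X^2) at P is p_n at the square of P. Hence P is recovered from its square, which
  is uniqueness of the positive root.\<close>

lemma sqrt_square:
  assumes "positive_op P"
  shows "fun_calc sqrt (P o\<^sub>L P) = P"
proof -
  define M where "M = norm P"
  have P: "between_op 0 M P" unfolding M_def by (rule positive_between[OF assms])
  have sa: "selfadj P" by (rule between_op_selfadj[OF P])
  have PP: "between_op 0 (M\<^sup>2) (P o\<^sub>L P)"
    using norm_blinfun_sq[of P]
    by (simp add: between_op_def selfadj_square sa inner_square M_def)
  have "continuous_on {0..M\<^sup>2} sqrt" by (intro continuous_intros)
  then obtain p where p: "uniform_limit {0..M\<^sup>2} (\<lambda>n. poly (p n)) sqrt sequentially"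
    using poly_approx by blast
  let ?q = "\<lambda>n. pcompose (p n) ([:0, 1:] * [:0, 1:])"
  have q: "uniform_limit {0..M} (\<lambda>n. poly (?q n)) (\<lambda>x. sqrt (x * x)) sequentially"
  proof (rule uniform_limitI)
    fix e :: real assume "0 < e"
    with p have "\<forall>\<^sub>F n in sequentially. \<forall>x\<in>{0..M\<^sup>2}. dist (poly (p n) x) (sqrt x) < e"
      by (rule uniform_limitD)
    then show "\<forall>\<^sub>F n in sequentially. \<forall>x\<in>{0..M}. dist (poly (?q n) x) (sqrt (x * x)) < e"
    proof eventually_elim
      case (elim n)
      have "x * x \<in> {0..M\<^sup>2}" if "x \<in> {0..M}" for x
        using that by (auto simp: power2_eq_square mult_mono)
      with elim show ?case by (simp add: poly_pcompose del: real_sqrt_mult_self real_sqrt_abs2)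
    qed
  qed
  have "(\<lambda>n. poly_op (?q n) P) \<longlonglongrightarrow> fun_calc (\<lambda>x. sqrt (x * x)) P"
    by (rule fun_calc_lim[OF P q])
  also have "(\<lambda>n. poly_op (?q n) P) = (\<lambda>n. poly_op (p n) (P o\<^sub>L P))"
    by (simp only: poly_op_pcompose poly_op_mult poly_op_X)
  also have "fun_calc (\<lambda>x. sqrt (x * x)) P = fun_calc (\<lambda>x. x) P"
    by (rule fun_calc_cong[OF P]) (auto intro!: continuous_intros)
  also have "\<dots> = P" by (rule fun_calc_id[OF P])
  finally show ?thesis by (rule fun_calc_eqI[OF PP p])
qed

lemma positive_square_eq:
  assumes "positive_op P" "positive_op Q" "P o\<^sub>L P = Q o\<^sub>L Q"
  shows "P = Q"
  using assms by (metis sqrt_square)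

section \<open>Real powers of strictly positive operators\<close>

lemma strictly_positive_positive: "strictly_positive A \<Longrightarrow> positive_op A"
  by (simp add: strictly_positive_def)

lemma strictly_positive_selfadj: "strictly_positive A \<Longrightarrow> selfadj A"
  by (simp add: strictly_positive_def positive_op_iff)

text \<open>With R the square root, |x| \<le> K |A x| \<le> L |R x|, and |R x|^2 is the quadratic
  form of A. A positive lower end is what makes \<open>powr\<close> continuous on the interval for
  every exponent.\<close>

lemma strictly_positive_between:
  assumes "strictly_positive A"
  obtains a b where "0 < a" "between_op a b A"
proof -
  have p: "positive_op A" using assms by (simp add: strictly_positive_def)
  let ?R = "fun_calc sqrt A"
  note R = positive_sqrt[OF p]
  have A: "A x = ?R (?R x)" for x using R(2) by (metis blinfun_apply_blinfun_compose)
  obtain K where K: "K > 0" "\<And>x. norm x \<le> K * norm (A x)"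
    using assms invertible_bounded_below unfolding strictly_positive_def by blast
  define L where "L = K * (norm ?R + 1)"
  have L: "L > 0" using K by (simp add: L_def add_nonneg_pos)
  have "1 / L\<^sup>2 * (norm x)\<^sup>2 \<le> inner x (A x)" for x
  proof -
    have "norm (A x) \<le> (norm ?R + 1) * norm (?R x)"
      using norm_blinfun[of ?R "?R x"] norm_ge_zero[of "?R x"] unfolding A distrib_right by linarith
    then have "norm x \<le> L * norm (?R x)"
      using K(2)[of x] K(1) unfolding L_def mult.assoc
      by (meson mult_le_cancel_left_pos order_trans)
    then have "(norm x)\<^sup>2 \<le> L\<^sup>2 * (norm (?R x))\<^sup>2"
      using power_mono[of "norm x" _ 2] by (metis norm_ge_zero power_mult_distrib)
    also have "(norm (?R x))\<^sup>2 = inner x (A x)" by (simp only: A inner_square[OF R(1)])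
    finally show ?thesis using L by (simp add: field_simps)
  qed
  then have "between_op (1 / L\<^sup>2) (norm A) A"
    using positive_between[OF p] by (simp add: between_op_def)
  moreover have "0 < 1 / L\<^sup>2" using L by simp
  ultimately show ?thesis using that by blast
qed

lemma continuous_on_powr_Icc: "0 < a \<Longrightarrow> continuous_on {a..b} (\<lambda>x::real. x powr s)"
  by (intro continuous_intros) auto

lemma selfadj_op_powr: "strictly_positive A \<Longrightarrow> selfadj (op_powr A s)"
  unfolding op_powr_def
  by (metis strictly_positive_between selfadj_fun_calc continuous_on_powr_Icc)

lemma op_powr_add:
  assumes "strictly_positive A"
  shows "op_powr A (s + t) = op_powr A s o\<^sub>L op_powr A t"
proof -
  obtain a b where "0 < a" "between_op a b A" using strictly_positive_between[OF assms] .
  then show ?thesis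
    using fun_calc_mult[OF _ continuous_on_powr_Icc continuous_on_powr_Icc, of a b A s t]
    by (simp add: op_powr_def powr_add)
qed

lemma op_powr_one:
  assumes "strictly_positive A"
  shows "op_powr A 1 = A"
proof -
  obtain a b where a: "0 < a" and A: "between_op a b A" using strictly_positive_between[OF assms] .
  have "op_powr A 1 = fun_calc (\<lambda>x. x) A"
    unfolding op_powr_def
    using a by (intro fun_calc_cong[OF A] continuous_on_powr_Icc continuous_intros) auto
  then show ?thesis by (simp add: fun_calc_id[OF A])
qed

lemma op_powr_zero:
  assumes "strictly_positive A"
  shows "op_powr A 0 = id_blinfun"
proof -
  obtain a b where a: "0 < a" and A: "between_op a b A" using strictly_positive_between[OF assms] .
  have "op_powr A 0 = fun_calc (poly [:1:]) A"
    unfolding op_powr_def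
    using a by (intro fun_calc_cong[OF A] continuous_on_powr_Icc continuous_intros) auto
  then show ?thesis by (simp only: fun_calc_poly[OF A] poly_op_const scaleR_one)
qed

lemma op_powr_apply_apply:
  assumes "strictly_positive A"
  shows "op_powr A s (op_powr A t x) = op_powr A (s + t) x"
  by (simp add: op_powr_add[OF assms])

lemma op_powr_minus:
  assumes "strictly_positive A"
  shows "op_powr A s o\<^sub>L op_powr A (- s) = id_blinfun" "op_powr A (- s) o\<^sub>L op_powr A s = id_blinfun"
  by (simp_all add: op_powr_add[OF assms, symmetric] op_powr_zero[OF assms])

lemma op_powr_half: "strictly_positive A \<Longrightarrow> op_powr A (s / 2) o\<^sub>L op_powr A (s / 2) = op_powr A s"
  by (simp add: op_powr_add[symmetric])

text \<open>The power s is the square of the self-adjoint power s/2, and the power -s inverts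
  it.\<close>

lemma strictly_positive_op_powr:
  assumes "strictly_positive A"
  shows "strictly_positive (op_powr A s)"
proof -
  have "positive_op (op_powr A s)"
    using positive_square[OF selfadj_op_powr[OF assms, of "s / 2"]] by (simp add: op_powr_half[OF assms])
  then show ?thesis
    unfolding strictly_positive_def invertible_op_def
    using op_powr_minus[OF assms] selfadj_clinear[OF selfadj_op_powr[OF assms]] by blast
qed

lemma strictly_positive_sandwich:
  assumes S: "strictly_positive S" and B: "strictly_positive B"
  shows "strictly_positive (S o\<^sub>L B o\<^sub>L S)"
proof -
  have "inner x (S (B (S x))) = inner (S x) (B (S x))" for x
    by (simp add: selfadjD strictly_positive_selfadj[OF S])
  then show ?thesis
    using assms unfolding strictly_positive_def positive_op_iff
    by (auto intro: invertible_compose selfadj_sandwich)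
qed

text \<open>The function x^r is uniformly continuous on the compact rectangle of exponents within 1
  of s0 and points of [a, b], so the power functions converge uniformly on [a, b].\<close>

lemma op_powr_tendsto:
  assumes A: "strictly_positive A" and s: "s \<longlonglongrightarrow> s0"
  shows "(\<lambda>n. op_powr A (s n)) \<longlonglongrightarrow> op_powr A s0"
proof (rule tendstoI)
  obtain a b where a: "0 < a" and A: "between_op a b A" using strictly_positive_between[OF A] .
  fix e :: real assume e: "0 < e"
  have "continuous_on ({s0 - 1..s0 + 1} \<times> {a..b}) (\<lambda>(r, x). x powr r)"
    using a by (auto intro!: continuous_intros simp: case_prod_beta)
  then have "uniformly_continuous_on ({s0 - 1..s0 + 1} \<times> {a..b}) (\<lambda>(r, x). x powr r)"
    by (intro compact_uniformly_continuous compact_Times compact_Icc)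
  then obtain d where d: "d > 0" "\<forall>p\<in>{s0 - 1..s0 + 1} \<times> {a..b}. \<forall>q\<in>{s0 - 1..s0 + 1} \<times> {a..b}.
      dist q p < d \<longrightarrow> dist ((\<lambda>(r, x). x powr r) q) ((\<lambda>(r, x). x powr r) p) < e / 2"
    unfolding uniformly_continuous_on_def using half_gt_zero[OF e] by meson
  have "\<forall>\<^sub>F n in sequentially. dist (s n) s0 < min d 1"
    using s d(1) by (intro tendstoD) auto
  then show "\<forall>\<^sub>F n in sequentially. dist (op_powr A (s n)) (op_powr A s0) < e"
  proof eventually_elim
    case (elim n)
    have "norm (op_powr A (s n) - op_powr A s0) \<le> e / 2"
      unfolding op_powr_def
    proof (rule norm_fun_calc_diff_le[OF A])
      show "\<bar>x powr s n - x powr s0\<bar> \<le> e / 2" if "x \<in> {a..b}" for x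
      proof -
        have "s n \<in> {s0 - 1..s0 + 1}" using elim by (auto simp: dist_real_def)
        moreover have "dist (s n, x) (s0, x) < d" using elim by (simp add: dist_Pair_Pair)
        ultimately have "dist (x powr s n) (x powr s0) < e / 2" 
          using that d(2)[THEN bspec[of _ _ "(s0, x)"], THEN bspec[of _ _ "(s n, x)"]] by simp
        then show ?thesis by (simp add: dist_real_def)
      qed
    qed (use a e in \<open>auto intro: continuous_on_powr_Icc\<close>)
    then show ?case using e by (simp add: dist_norm)
  qed
qed

text \<open>Sums and negatives reach the integers, halving the dyadic rationals, and density the
  rest.\<close>

lemma dyadic_induct:
  fixes P :: "real \<Rightarrow> bool"
  assumes one: "P 1" and add: "\<And>s t. P s \<Longrightarrow> P t \<Longrightarrow> P (s + t)" and minus: "\<And>s. P s \<Longrightarrow> P (- s)"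
    and half: "\<And>s. P s \<Longrightarrow> P (s / 2)" and lim: "\<And>s s0. (\<And>n. P (s n)) \<Longrightarrow> s \<longlonglongrightarrow> s0 \<Longrightarrow> P s0"
  shows "P r"
proof -
  have zero: "P 0" using add[OF one minus[OF one]] by simp
  have nat: "P (real n)" for n
    by (induction n) (auto simp: zero add one)
  have int: "P (real_of_int k)" for k
    by (cases k) (use nat minus[OF nat] in \<open>auto simp del: of_nat_Suc\<close>)
  have dyadic: "P (real_of_int k / 2 ^ n)" for k n
  proof (induction n)
    case (Suc n)
    from half[OF Suc] show ?case by (simp add: field_simps)
  qed (simp add: int)
  \<comment> \<open>Rounding r down to a multiple of 2^-n costs at most 2^-n.\<close>
  have "(\<lambda>n. real_of_int \<lfloor>r * 2 ^ n\<rfloor> / 2 ^ n) \<longlonglongrightarrow> r"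
  proof (rule LIMSEQ_I)
    fix e :: real assume "0 < e"
    then obtain N where N: "(1 / 2) ^ N < e" using real_arch_pow_inv[of e "1/2"] by auto
    have "norm (real_of_int \<lfloor>r * 2 ^ n\<rfloor> / 2 ^ n - r) < e" if "n \<ge> N" for n
    proof -
      have "\<bar>real_of_int \<lfloor>r * 2 ^ n\<rfloor> - r * 2 ^ n\<bar> \<le> 1" by linarith
      then have "\<bar>real_of_int \<lfloor>r * 2 ^ n\<rfloor> - r * 2 ^ n\<bar> / 2 ^ n \<le> 1 / 2 ^ n" by (simp add: divide_right_mono)
      moreover have "real_of_int \<lfloor>r * 2 ^ n\<rfloor> / 2 ^ n - r = (real_of_int \<lfloor>r * 2 ^ n\<rfloor> - r * 2 ^ n) / 2 ^ n"
        by (simp add: diff_divide_distrib)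
      then have "\<bar>real_of_int \<lfloor>r * 2 ^ n\<rfloor> - r * 2 ^ n\<bar> / 2 ^ n = \<bar>real_of_int \<lfloor>r * 2 ^ n\<rfloor> / 2 ^ n - r\<bar>"
        by (simp only: abs_divide abs_power_minus power_abs abs_numeral)
      moreover have "1 / 2 ^ n \<le> (1 / 2 :: real) ^ N"
        using power_decreasing[OF that, of "1/2 :: real"] by (simp add: power_one_over)
      ultimately show ?thesis using N by simp
    qed
    then show "\<exists>no. \<forall>n\<ge>no. norm (real_of_int \<lfloor>r * 2 ^ n\<rfloor> / 2 ^ n - r) < e" by blast
  qed
  then show ?thesis by (rule lim[OF dyadic])
qed

section \<open>Tensor products of operators\<close>

text \<open>A relation H is used instead of a function because single-valuedness is part of what has
  to be proved. The operator has the closure of H as its graph.\<close>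

lemma blinfun_from_graph:
  fixes H :: "('a::real_normed_vector \<times> 'b::banach) set"
  assumes H: "subspace H" and bound: "\<And>u v. (u, v) \<in> H \<Longrightarrow> norm v \<le> c * norm u"
    and dense: "closure (fst ` H) = UNIV"
  shows "\<exists>C :: 'a \<Rightarrow>\<^sub>L 'b. \<forall>u v. (u, v) \<in> H \<longrightarrow> C u = v"
proof -
  define G where "G = closure H"
  have G: "subspace G" 
    unfolding G_def subspace_def
  proof (intro conjI ballI allI)
    show "0 \<in> closure H" using subspace_0[OF H] closure_subset by blast
    fix p q assume p: "p \<in> closure H"
    then obtain x where x: "\<And>n. x n \<in> H" "x \<longlonglongrightarrow> p" unfolding closure_sequential by blast
    show "r *\<^sub>R p \<in> closure H" for r
      unfolding closure_sequential
      by (intro exI[of _ "\<lambda>n. r *\<^sub>R x n"] conjI allI subspace_scale H x tendsto_intros)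
    assume "q \<in> closure H"
    then obtain y where y: "\<And>n. y n \<in> H" "y \<longlonglongrightarrow> q" unfolding closure_sequential by blast
    show "p + q \<in> closure H"
      unfolding closure_sequential
      by (intro exI[of _ "\<lambda>n. x n + y n"] conjI allI subspace_add H x y tendsto_intros)
  qed
  have "closed {p :: 'a \<times> 'b. norm (snd p) \<le> c * norm (fst p)}"
    by (intro closed_Collect_le continuous_intros)
  then have "G \<subseteq> {p. norm (snd p) \<le> c * norm (fst p)}"
    unfolding G_def by (intro closure_minimal) (use bound in auto)
  then have G_bound: "norm v \<le> c * norm u" if "(u, v) \<in> G" for u v using that by auto
  \<comment> \<open>The difference of two values over u lies over 0, where the norm bound leaves
    only 0.\<close>
  have unique: "v = v'" if "(u, v) \<in> G" "(u, v') \<in> G" for u v v'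
    using subspace_diff[OF G that] G_bound[of 0 "v - v'"] by simp
  \<comment> \<open>Density approximates u by first components; by the bound the second components
    are Cauchy and so converge in the Banach space.\<close>
  have total: "\<exists>v. (u, v) \<in> G" for u
  proof -
    have "u \<in> closure (fst ` H)" by (simp add: dense)
    then obtain x where x: "\<And>n. x n \<in> fst ` H" "x \<longlonglongrightarrow> u" unfolding closure_sequential by blast
    then have "\<forall>n. \<exists>v. (x n, v) \<in> H" by force
    then obtain v where v: "\<And>n. (x n, v n) \<in> H" by metis
    have le: "norm (v m - v n) \<le> c * norm (x m - x n)" for m n
      using bound subspace_diff[OF H v[of m] v[of n]] by simp
    have "Cauchy v"
    proof (rule metric_CauchyI)
      fix e :: real assume e: "0 < e"
      have "Cauchy x" using x(2) by (rule LIMSEQ_imp_Cauchy)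
      then obtain N where N: "\<And>m n. m \<ge> N \<Longrightarrow> n \<ge> N \<Longrightarrow> dist (x m) (x n) < e / (\<bar>c\<bar> + 1)"
        using e metric_CauchyD[of x "e / (\<bar>c\<bar> + 1)"] by auto
      have "dist (v m) (v n) < e" if "m \<ge> N" "n \<ge> N" for m n
      proof -
        have "norm (v m - v n) \<le> (\<bar>c\<bar> + 1) * norm (x m - x n)"
          using le[of m n] by (rule order_trans) (simp add: mult_right_mono)
        also have "\<dots> < e" using N[OF that] by (simp add: dist_norm field_simps)
        finally show ?thesis by (simp add: dist_norm)
      qed
      then show "\<exists>M. \<forall>m\<ge>M. \<forall>n\<ge>M. dist (v m) (v n) < e" by blast
    qed
    then obtain l where "v \<longlonglongrightarrow> l" using Cauchy_convergent convergent_def by blast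
    then have "(\<lambda>n. (x n, v n)) \<longlonglongrightarrow> (u, l)" using x(2) by (intro tendsto_Pair)
    then have "(u, l) \<in> G" 
      unfolding G_def closure_sequential by (intro exI[of _ "\<lambda>n. (x n, v n)"]) (simp add: v)
    then show ?thesis by blast
  qed
  then obtain f where f: "\<And>u. (u, f u) \<in> G" by metis
  have "bounded_linear f"
  proof (rule bounded_linear_intro[where K = c])
    show "f (x + y) = f x + f y" for x y
      using subspace_add[OF G f[of x] f[of y]] by (intro unique[OF f]) simp
    show "f (r *\<^sub>R x) = r *\<^sub>R f x" for r x
      using subspace_scale[OF G f[of x], of r] by (intro unique[OF f]) simp
    show "norm (f x) \<le> norm x * c" for x
      using G_bound[OF f[of x]] by (simp add: mult.commute)
  qed
  then have "Blinfun f u = v" if "(u, v) \<in> H" for u v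
    using that unique[OF f] closure_subset[of H] unfolding G_def[symmetric]
    by (auto simp: bounded_linear_Blinfun_apply)
  then show ?thesis by blast
qed

lemma selfadj_cinner: "selfadj A \<Longrightarrow> cinner (A x) y = cinner x (A y)"
  unfolding cinner_ii[of "A x"] cinner_ii[of x]
  by (simp add: selfadjD clinear_opD[OF selfadj_clinear, symmetric])

lemma hilbert_tensorD:
  assumes "hilbert_tensor t"
  shows hilbert_tensor_add_left: "t (x + x') y = t x y + t x' y"
    and hilbert_tensor_add_right: "t x (y + y') = t x y + t x y'"
    and hilbert_tensor_scaleC_left: "t (c *\<^sub>C x) y = c *\<^sub>C t x y"
    and hilbert_tensor_scaleC_right: "t x (c *\<^sub>C y) = c *\<^sub>C t x y"
    and hilbert_tensor_cinner: "cinner (t x y) (t x' y') = cinner x x' * cinner y y'"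
    and hilbert_tensor_dense: "closure (span {t x y | x y. True}) = UNIV"
  using assms unfolding hilbert_tensor_def by blast+

lemma hilbert_tensor_inner:
  "hilbert_tensor t \<Longrightarrow> inner (t x y) (t x' y') = Re (cinner x x' * cinner y y')"
  by (simp add: hilbert_tensor_cinner[symmetric] Re_cinner)

text \<open>Transfers the construction for the first factor to the second.\<close>

lemma hilbert_tensor_swap:
  assumes "hilbert_tensor t"
  shows "hilbert_tensor (\<lambda>y x. t x y)"
proof -
  have "{t x y | y x. True} = {t x y | x y. True}" by blast
  then show ?thesis
    using assms unfolding hilbert_tensor_def by (simp add: mult.commute)
qed

lemma cinner_self: "cinner x x = complex_of_real ((norm x)\<^sup>2)"
  using cinner_commute[of x x] Re_cinner[of x x] by (simp add: complex_eq_iff power2_norm_eq_inner)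

lemma bounded_bilinear_hilbert_tensor:
  assumes t: "hilbert_tensor t"
  shows "bounded_bilinear t"
proof
  show "t (r *\<^sub>R x) y = r *\<^sub>R t x y" "t x (r *\<^sub>R y) = r *\<^sub>R t x y" for r x y
    by (simp_all add: hilbert_tensor_scaleC_left[OF t] hilbert_tensor_scaleC_right[OF t]
        flip: scaleC_of_real)
  have "(norm (t x y))\<^sup>2 = (norm x * norm y)\<^sup>2" for x y
    by (simp add: power2_norm_eq_inner hilbert_tensor_inner[OF t] cinner_self power_mult_distrib
        flip: of_real_mult)
  then have "norm (t x y) = norm x * norm y" for x y
    by (simp add: power2_eq_iff_nonneg)
  then show "\<exists>K. \<forall>x y. norm (t x y) \<le> norm x * norm y * K"
    by (intro exI[of _ 1]) simp
qed (simp_all add: hilbert_tensor_add_left[OF t] hilbert_tensor_add_right[OF t])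

text \<open>A closed subspace containing all elementary tensors contains the closure of their span,
  which is everything.\<close>

lemma hilbert_tensor_induct:
  assumes t: "hilbert_tensor t" and "subspace {z. P z}" and "closed {z. P z}"
    and "\<And>x y. P (t x y)"
  shows "P z"
proof -
  have "span {t x y | x y. True} \<subseteq> {z. P z}"
    using assms(2,4) by (intro span_minimal) auto
  then have "closure (span {t x y | x y. True}) \<subseteq> {z. P z}"
    using assms(3) by (rule closure_minimal)
  then show ?thesis unfolding hilbert_tensor_dense[OF t] by blast
qed

lemma hilbert_tensor_blinfun_eqI:
  assumes t: "hilbert_tensor t" and eq: "\<And>x y. blinfun_apply C (t x y) = blinfun_apply D (t x y)"
  shows "C = D"
proof (rule blinfun_eqI)
  show "C z = D z" for z
    using t
  proof (rule hilbert_tensor_induct)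
    show "subspace {z. C z = D z}"
      by (auto simp: subspace_def blinfun.add_right blinfun.scaleR_right)
    show "closed {z. C z = D z}"
      by (intro closed_Collect_eq continuous_intros)
  qed (rule eq)
qed

lemma tensor_op_eqI:
  assumes t: "hilbert_tensor t" and "clinear_op C" and "\<And>x y. blinfun_apply C (t x y) = t (blinfun_apply A x) (blinfun_apply B y)"
  shows "tensor_op t A B = C"
  unfolding tensor_op_def
proof (rule the_equality)
  show "D = C" if "clinear_op D \<and> (\<forall>x y. D (t x y) = t (A x) (B y))" for D
    by (rule hilbert_tensor_blinfun_eqI[OF t]) (use that assms in simp)
qed (use assms in blast)

text \<open>With \<open>R = sqrt (c\<^sup>2 - A\<^sup>2)\<close>, \<open>c = norm A\<close>, every finite sum satisfies
  \<open>c\<^sup>2 * (norm (\<Sum> x\<^sub>i \<otimes> y\<^sub>i))\<^sup>2 = (norm (\<Sum> A x\<^sub>i \<otimes> y\<^sub>i))\<^sup>2 + (norm (\<Sum> R x\<^sub>i \<otimes> y\<^sub>i))\<^sup>2\<close>. This gives both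
  that \<open>A \<otimes> 1\<close> is well defined on the algebraic tensor product and that it is bounded there.\<close>

lemma tensor_op_left_exists:
  fixes t :: "'a::chilbert_space \<Rightarrow> 'b::chilbert_space \<Rightarrow> 'c::chilbert_space"
  assumes t: "hilbert_tensor t" and A: "selfadj A"
  shows "\<exists>C. clinear_op C \<and> (\<forall>x y. C (t x y) = t (A x) y)"
proof -
  define c where "c = norm A"
  let ?N = "c\<^sup>2 *\<^sub>R id_blinfun - (A o\<^sub>L A)"
  have "positive_op ?N"
    using norm_blinfun_sq[of A]
    by (simp add: positive_op_iff selfadj_diff selfadj_scaleR selfadj_id selfadj_square A
        blinfun.diff_left blinfun.scaleR_left inner_diff_right inner_square c_def
        flip: power2_norm_eq_inner)
  then obtain R where R: "selfadj R" and RR: "R o\<^sub>L R = ?N" using positive_sqrt by blast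
  have "R (R x) = c\<^sup>2 *\<^sub>R x - A (A x)" for x
    using arg_cong[OF RR, of "\<lambda>X. blinfun_apply X x"] by (simp add: blinfun.diff_left blinfun.scaleR_left)
  then have "R (R x) + A (A x) = complex_of_real (c\<^sup>2) *\<^sub>C x" for x
    by (simp add: scaleC_of_real del: of_real_power)
  \<comment> \<open>Moving A and R to the right turns this into A^2 + R^2 = c^2.\<close>
  then have AR: "cinner (A x) (A x') + cinner (R x) (R x') = complex_of_real (c\<^sup>2) * cinner x x'" for x x'
    unfolding selfadj_cinner[OF A] selfadj_cinner[OF R] cinner_scaleC_right[symmetric]
    by (metis cinner_add_right add.commute)
  \<comment> \<open>The triples carry the R-component along, so that the norm identity stays exact
    on the span.\<close>
  let ?S = "{(t x y, t (A x) y, t (R x) y) | x y. True}"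
  define G where "G = span ?S"
  \<comment> \<open>The polarized norm identity. Unlike the quadratic form it is linear in each
    argument, so it spreads from the generators to the span one argument at a time.\<close>
  define Q where "Q p q \<longleftrightarrow> c\<^sup>2 * inner (fst p) (fst q)
      = inner (fst (snd p)) (fst (snd q)) + inner (snd (snd p)) (snd (snd q))" for p q :: "'c \<times> 'c \<times> 'c"
  have subspace_Q: "subspace {q. Q p q}" "subspace {q. Q q p}" for p
    by (auto simp: subspace_def Q_def inner_add_right inner_add_left algebra_simps)
  have gen: "Q p q" if "p \<in> ?S" "q \<in> ?S" for p q
  proof -
    from that obtain x y x' y' where pq: "p = (t x y, t (A x) y, t (R x) y)" "q = (t x' y', t (A x') y', t (R x') y')"
      by blast
    have "c\<^sup>2 * Re (cinner x x' * cinner y y') = Re (complex_of_real (c\<^sup>2) * cinner x x' * cinner y y')"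
      by (simp only: mult.assoc Re_complex_of_real Re_complex_of_real times_complex.sel Im_complex_of_real)
    also have "\<dots> = Re (cinner (A x) (A x') * cinner y y') + Re (cinner (R x) (R x') * cinner y y')"
      by (simp only: AR[symmetric] distrib_right plus_complex.sel)
    finally show ?thesis
      unfolding pq Q_def by (simp only: fst_conv snd_conv hilbert_tensor_inner[OF t])
  qed
  have left: "Q p q" if p: "p \<in> ?S" and "q \<in> G" for p q
    using \<open>q \<in> G\<close> unfolding G_def by (rule span_induct) (rule subspace_Q, rule gen[OF p])
  have Q: "Q p q" if p: "p \<in> G" and q: "q \<in> G" for p q
    using p unfolding G_def by (rule span_induct) (rule subspace_Q, rule left[OF _ q])
  define H where "H = (\<lambda>p. (fst p, fst (snd p))) ` G"
  have lin: "linear (\<lambda>p::'c \<times> 'c \<times> 'c. (fst p, fst (snd p)))"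
    by (rule linearI) auto
  have "subspace H" unfolding H_def G_def by (intro linear_subspace_image lin subspace_span)
  moreover have "norm v \<le> c * norm u" if "(u, v) \<in> H" for u v
  proof -
    from that obtain w where "(u, v, w) \<in> G" by (auto simp: H_def)
    from Q[OF this this] have "c\<^sup>2 * (norm u)\<^sup>2 = (norm v)\<^sup>2 + (norm w)\<^sup>2"
      by (simp add: Q_def power2_norm_eq_inner)
    then have "(norm v)\<^sup>2 \<le> (c * norm u)\<^sup>2" by (simp add: power_mult_distrib)
    then show ?thesis by (rule power2_le_imp_le) (simp add: c_def)
  qed
  moreover have "closure (fst ` H) = UNIV"
  proof -
    have "fst ` H = fst ` G" by (force simp: H_def)
    also have "\<dots> = span (fst ` ?S)" unfolding G_def by (rule linear_span_image[OF linear_fst, symmetric])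
    also have "fst ` ?S = {t x y | x y. True}" by force
    finally show ?thesis by (simp only: hilbert_tensor_dense[OF t])
  qed
  ultimately have "\<exists>C :: 'c \<Rightarrow>\<^sub>L 'c. \<forall>u v. (u, v) \<in> H \<longrightarrow> C u = v"
    by (rule blinfun_from_graph)
  then obtain C :: "'c \<Rightarrow>\<^sub>L 'c" where C: "\<And>u v. (u, v) \<in> H \<Longrightarrow> C u = v" by blast
  have C_t: "C (t x y) = t (A x) y" for x y
  proof (rule C)
    have "(t x y, t (A x) y, t (R x) y) \<in> G" unfolding G_def by (rule span_base) blast
    then show "(t x y, t (A x) y) \<in> H" by (force simp: H_def)
  qed
  have "C o\<^sub>L scalar_op z = scalar_op z o\<^sub>L C" for z
    by (rule hilbert_tensor_blinfun_eqI[OF t])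
      (simp add: C_t clinear_opD[OF selfadj_clinear[OF A]] flip: hilbert_tensor_scaleC_left[OF t])
  then have "clinear_op C"
    unfolding clinear_op_def by (metis blinfun_apply_blinfun_compose scalar_op_apply)
  with C_t show ?thesis by blast
qed

text \<open>The product of A (x) 1 and 1 (x) B.\<close>

lemma tensor_op_exists:
  assumes t: "hilbert_tensor t" and A: "selfadj A" and B: "selfadj B"
  shows "\<exists>C. clinear_op C \<and> (\<forall>x y. C (t x y) = t (A x) (B y))"
proof -
  obtain C where "clinear_op C" "\<And>x y. C (t x y) = t (A x) y"
    using tensor_op_left_exists[OF t A] by blast
  moreover obtain D where "clinear_op D" "\<And>x y. D (t x y) = t x (B y)"
    using tensor_op_left_exists[OF hilbert_tensor_swap[OF t] B] by blast
  ultimately show ?thesis by (intro exI[of _ "C o\<^sub>L D"]) (simp add: clinear_compose)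
qed

lemma tensor_op_props:
  assumes "hilbert_tensor t" "selfadj A" "selfadj B"
  shows tensor_op_apply: "tensor_op t A B (t x y) = t (A x) (B y)"
    and clinear_tensor_op: "clinear_op (tensor_op t A B)"
  using tensor_op_exists[OF assms] tensor_op_eqI[OF assms(1)] by metis+

lemma selfadj_tensor_op:
  assumes t: "hilbert_tensor t" and A: "selfadj A" and B: "selfadj B"
  shows "selfadj (tensor_op t A B)"
proof -
  let ?C = "tensor_op t A B"
  have "inner (?C u) v = inner u (?C v)" for u v
    using t
  proof (rule hilbert_tensor_induct[where z = u])
    fix x y
    show "inner (?C (t x y)) v = inner (t x y) (?C v)"
      using t
    proof (rule hilbert_tensor_induct[where z = v])
      show "inner (?C (t x y)) (t x' y') = inner (t x y) (?C (t x' y'))" for x' y'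
        by (simp add: tensor_op_apply[OF assms] hilbert_tensor_inner[OF t] selfadj_cinner[OF A] selfadj_cinner[OF B])
    qed (auto simp: subspace_def blinfun.add_right blinfun.scaleR_right inner_add_right
        intro!: closed_Collect_eq continuous_intros)
  qed (auto simp: subspace_def blinfun.add_right blinfun.scaleR_right inner_add_left
      intro!: closed_Collect_eq continuous_intros)
  then show ?thesis by (simp add: selfadj_def clinear_tensor_op[OF assms])
qed

lemma tensor_op_compose:
  assumes t: "hilbert_tensor t"
    and "selfadj A" "selfadj B" "selfadj A'" "selfadj B'"
  shows "tensor_op t (A o\<^sub>L A') (B o\<^sub>L B') = tensor_op t A B o\<^sub>L tensor_op t A' B'"
  by (rule tensor_op_eqI[OF t])
    (simp_all add: assms tensor_op_apply clinear_tensor_op clinear_compose)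

text \<open>It is the square of the self-adjoint tensor product of the square roots.\<close>

lemma positive_tensor_op:
  assumes t: "hilbert_tensor t" and "positive_op A" "positive_op B"
  shows "positive_op (tensor_op t A B)"
proof -
  note R = positive_sqrt[OF assms(2)] positive_sqrt[OF assms(3)]
  have "tensor_op t A B = tensor_op t (fun_calc sqrt A) (fun_calc sqrt B) o\<^sub>L
      tensor_op t (fun_calc sqrt A) (fun_calc sqrt B)"
    by (simp add: R t flip: tensor_op_compose)
  then show ?thesis using positive_square selfadj_tensor_op[OF t R(1) R(3)] by metis
qed

lemma tensor_op_id:
  assumes "hilbert_tensor t"
  shows "tensor_op t id_blinfun id_blinfun = id_blinfun"
  by (rule tensor_op_eqI[OF assms clinear_id]) simp

section \<open>Inverses and powers of tensor products\<close>

lemma tensor_op_powr_minus: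
  assumes "hilbert_tensor t" "strictly_positive A" "strictly_positive B"
  shows "tensor_op t (op_powr A s) (op_powr B s) o\<^sub>L tensor_op t (op_powr A (- s)) (op_powr B (- s)) = id_blinfun"
    and "tensor_op t (op_powr A (- s)) (op_powr B (- s)) o\<^sub>L tensor_op t (op_powr A s) (op_powr B s) = id_blinfun"
  using assms by (simp_all add: tensor_op_compose[symmetric] selfadj_op_powr op_powr_minus tensor_op_id)

lemma strictly_positive_tensor_op:
  assumes t: "hilbert_tensor t" and A: "strictly_positive A" and B: "strictly_positive B"
  shows "strictly_positive (tensor_op t A B)"
  unfolding strictly_positive_def invertible_op_def
proof (intro conjI exI)
  show "positive_op (tensor_op t A B)"
    using A B by (intro positive_tensor_op t) (auto simp: strictly_positive_def)
  show "clinear_op (tensor_op t (op_powr A (- 1)) (op_powr B (- 1)))"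
    using assms by (intro clinear_tensor_op selfadj_op_powr)
qed (use tensor_op_powr_minus[OF assms, of 1] in \<open>simp_all add: op_powr_one A B\<close>)

theorem op_powr_tensor_op:
  assumes t: "hilbert_tensor t" and A: "strictly_positive A" and B: "strictly_positive B"
  shows "op_powr (tensor_op t A B) s = tensor_op t (op_powr A s) (op_powr B s)"
proof (induction s rule: dyadic_induct)
  let ?T = "tensor_op t A B"
  let ?P = "\<lambda>s. tensor_op t (op_powr A s) (op_powr B s)"
  have T: "strictly_positive ?T" by (rule strictly_positive_tensor_op[OF assms])
  note sa = selfadj_op_powr[OF A] selfadj_op_powr[OF B]
  note pos = strictly_positive_positive[OF strictly_positive_op_powr]
  show "op_powr ?T 1 = ?P 1" by (simp add: op_powr_one T A B)
  show "op_powr ?T (s + u) = ?P (s + u)" if "op_powr ?T s = ?P s" "op_powr ?T u = ?P u" for s u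
    using that by (simp add: op_powr_add T A B tensor_op_compose t sa)
  show "op_powr ?T (- s) = ?P (- s)" if s: "op_powr ?T s = ?P s" for s
  proof -
    \<comment> \<open>Uniqueness of inverses: by assumption \<open>?P s\<close> is the power s of
      \<open>?T\<close>, so its right inverse \<open>?P (- s)\<close> must be the power -s.\<close>
    have "op_powr ?T (- s) = op_powr ?T (- s) o\<^sub>L (?P s o\<^sub>L ?P (- s))"
      by (rule blinfun_eqI) (simp add: tensor_op_powr_minus[OF assms])
    also have "\<dots> = (op_powr ?T (- s) o\<^sub>L op_powr ?T s) o\<^sub>L ?P (- s)"
      unfolding s by (rule blinfun_eqI) simp
    also have "\<dots> = ?P (- s)" by (rule blinfun_eqI) (simp add: op_powr_minus[OF T])
    finally show ?thesis .
  qed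
  show "op_powr ?T (s / 2) = ?P (s / 2)" if s: "op_powr ?T s = ?P s" for s
  proof (rule positive_square_eq)
    show "positive_op (op_powr ?T (s / 2))" by (rule pos[OF T])
    show "positive_op (?P (s / 2))" by (intro positive_tensor_op t pos A B)
    show "op_powr ?T (s / 2) o\<^sub>L op_powr ?T (s / 2) = ?P (s / 2) o\<^sub>L ?P (s / 2)"
      by (simp add: op_powr_half T A B s t sa flip: tensor_op_compose)
  qed
  show "op_powr ?T r = ?P r" if eq: "\<And>n. op_powr ?T (s n) = ?P (s n)" and s: "s \<longlonglongrightarrow> r" for s r
  proof (rule tensor_op_eqI[OF t, symmetric])
    fix x y
    \<comment> \<open>Limits are compared on elementary tensors, where continuity of t suffices; no
      norm limit of the operators \<open>?P (s n)\<close> has to be established.\<close>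
    have "(\<lambda>n. op_powr ?T (s n) (t x y)) \<longlonglongrightarrow> op_powr ?T r (t x y)"
      by (intro tendsto_blinfun_apply op_powr_tendsto T s)
    moreover have "(\<lambda>n. op_powr ?T (s n) (t x y)) \<longlonglongrightarrow> t (op_powr A r x) (op_powr B r y)"
      unfolding eq tensor_op_apply[OF t sa]
      by (intro bounded_bilinear.tendsto[OF bounded_bilinear_hilbert_tensor[OF t]]
          tendsto_blinfun_apply op_powr_tendsto A B s)
    ultimately show "op_powr ?T r (t x y) = t (op_powr A r x) (op_powr B r y)"
      by (rule LIMSEQ_unique)
  qed (rule selfadj_clinear[OF selfadj_op_powr[OF T]])
qed

section \<open>Operator means and the inequalities\<close>

definition op_mean_base :: "('a::chilbert_space \<Rightarrow>\<^sub>L 'a) \<Rightarrow> ('a \<Rightarrow>\<^sub>L 'a) \<Rightarrow> 'a \<Rightarrow>\<^sub>L 'a" where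
  "op_mean_base A B = (op_powr A (-1/2) o\<^sub>L B o\<^sub>L op_powr A (-1/2))"

definition op_mean :: "real \<Rightarrow> ('a::chilbert_space \<Rightarrow>\<^sub>L 'a) \<Rightarrow> ('a \<Rightarrow>\<^sub>L 'a) \<Rightarrow> 'a \<Rightarrow>\<^sub>L 'a" where
  "op_mean l A B = (op_powr A (1/2) o\<^sub>L op_powr (op_mean_base A B) l o\<^sub>L op_powr A (1/2))"

lemma T_tilde_op_mean: "T_tilde l A B = (1 / l) *\<^sub>R (op_mean l A B - A)"
  by (simp add: T_tilde_def op_mean_def op_mean_base_def)

lemma strictly_positive_op_mean_base:
  assumes "strictly_positive A" "strictly_positive B"
  shows "strictly_positive (op_mean_base A B)"
  unfolding op_mean_base_def
  by (intro strictly_positive_sandwich strictly_positive_op_powr assms)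

lemma selfadj_op_mean:
  assumes "strictly_positive A" "strictly_positive B"
  shows "selfadj (op_mean l A B)"
  unfolding op_mean_def
  by (intro selfadj_sandwich selfadj_op_powr strictly_positive_op_mean_base assms)

lemma selfadj_T_tilde:
  assumes "strictly_positive A" "strictly_positive B"
  shows "selfadj (T_tilde l A B)"
  unfolding T_tilde_op_mean
  by (intro selfadj_scaleR selfadj_diff selfadj_op_mean strictly_positive_selfadj assms)

text \<open>Checked on elementary tensors: \<open>tensor_op_compose\<close> asks for self-adjoint
  factors, and the partial product of the power of A with B need not be self-adjoint.\<close>

lemma op_mean_base_tensor_op:
  assumes t: "hilbert_tensor t" and 1: "strictly_positive A1" "strictly_positive B1"
    and 2: "strictly_positive A2" "strictly_positive B2"
  shows "op_mean_base (tensor_op t A1 A2) (tensor_op t B1 B2)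
    = tensor_op t (op_mean_base A1 B1) (op_mean_base A2 B2)"
  unfolding op_mean_base_def op_powr_tensor_op[OF t 1(1) 2(1)]
  by (rule tensor_op_eqI[OF t, symmetric])
    (simp_all add: t 1 2 tensor_op_apply clinear_tensor_op clinear_compose selfadj_op_powr strictly_positive_selfadj)

lemma op_mean_tensor_op:
  assumes t: "hilbert_tensor t" and 1: "strictly_positive A1" "strictly_positive B1"
    and 2: "strictly_positive A2" "strictly_positive B2"
  shows "op_mean l (tensor_op t A1 A2) (tensor_op t B1 B2) = tensor_op t (op_mean l A1 B1) (op_mean l A2 B2)"
  unfolding op_mean_def op_powr_tensor_op[OF t 1(1) 2(1)] op_mean_base_tensor_op[OF assms]
    op_powr_tensor_op[OF t strictly_positive_op_mean_base[OF 1] strictly_positive_op_mean_base[OF 2]]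
  by (rule tensor_op_eqI[OF t, symmetric])
    (simp_all add: t 1 2 tensor_op_apply clinear_tensor_op clinear_compose selfadj_op_powr
      strictly_positive_op_mean_base)

lemma T_tilde_tensor_op:
  assumes t: "hilbert_tensor t" and l: "l \<noteq> 0"
    and 1: "strictly_positive A1" "strictly_positive B1"
    and 2: "strictly_positive A2" "strictly_positive B2"
  shows "T_tilde l (tensor_op t A1 A2) (tensor_op t B1 B2)
    = tensor_op t (T_tilde l A1 B1) A2 + tensor_op t A1 (T_tilde l A2 B2)
      + l *\<^sub>R tensor_op t (T_tilde l A1 B1) (T_tilde l A2 B2)"
proof (rule hilbert_tensor_blinfun_eqI[OF t])
  fix x y
  note sa = selfadj_T_tilde[OF 1] selfadj_T_tilde[OF 2] selfadj_op_mean[OF 1] selfadj_op_mean[OF 2]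
    strictly_positive_selfadj[OF 1(1)] strictly_positive_selfadj[OF 2(1)]
  interpret t: bounded_bilinear t by (rule bounded_bilinear_hilbert_tensor[OF t])
  have mean: "op_mean l A1 B1 x = A1 x + l *\<^sub>R T_tilde l A1 B1 x" "op_mean l A2 B2 y = A2 y + l *\<^sub>R T_tilde l A2 B2 y"
    using l by (simp_all add: T_tilde_op_mean blinfun.scaleR_left blinfun.diff_left)
  have "T_tilde l (tensor_op t A1 A2) (tensor_op t B1 B2) (t x y)
      = (1 / l) *\<^sub>R (t (op_mean l A1 B1 x) (op_mean l A2 B2 y) - t (A1 x) (A2 y))"
    unfolding T_tilde_op_mean[of l "tensor_op t A1 A2"] op_mean_tensor_op[OF t 1 2]
    by (simp add: blinfun.scaleR_left blinfun.diff_left tensor_op_apply t sa)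
  also have "\<dots> = t (T_tilde l A1 B1 x) (A2 y) + t (A1 x) (T_tilde l A2 B2 y)
      + l *\<^sub>R t (T_tilde l A1 B1 x) (T_tilde l A2 B2 y)"
    unfolding mean using l by (simp add: t.add_left t.add_right t.scaleR_left t.scaleR_right scaleR_add_right)
  finally show "T_tilde l (tensor_op t A1 A2) (tensor_op t B1 B2) (t x y)
    = (tensor_op t (T_tilde l A1 B1) A2 + tensor_op t A1 (T_tilde l A2 B2)
      + l *\<^sub>R tensor_op t (T_tilde l A1 B1) (T_tilde l A2 B2)) (t x y)"
    by (simp add: blinfun.scaleR_left blinfun.add_left tensor_op_apply t sa)
qed

section \<open>The sign of \<open>T_tilde\<close> for comparable operators\<close>

lemma inner_op_mean:
  assumes A: "strictly_positive A" and B: "strictly_positive B"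
  shows "inner x (op_mean l A B x) = inner (op_powr A (1/2) x)
    (op_powr (op_mean_base A B) l (op_powr A (1/2) x))"
  by (simp add: op_mean_def selfadjD[OF selfadj_op_powr[OF A]])

lemma norm_op_powr_half:
  assumes A: "strictly_positive A"
  shows "(norm (op_powr A (1/2) x))\<^sup>2 = inner x (A x)"
  by (simp add: inner_square[OF selfadj_op_powr[OF A], symmetric] op_powr_apply_apply A op_powr_one)

text \<open>Under the substitution of A^(-1/2) x for x, comparing B with A becomes comparing
  \<open>op_mean_base A B\<close> with the identity.\<close>

lemma inner_op_mean_base:
  assumes A: "strictly_positive A"
  shows "inner x ((op_mean_base A B) x)
      = inner (op_powr A (-1/2) x) (B (op_powr A (-1/2) x))"
    and "inner (op_powr A (-1/2) x) (A (op_powr A (-1/2) x)) = (norm x)\<^sup>2"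
proof -
  show "inner x ((op_mean_base A B) x)
      = inner (op_powr A (-1/2) x) (B (op_powr A (-1/2) x))"
    by (simp add: op_mean_base_def selfadjD[OF selfadj_op_powr[OF A]])
  have "op_powr A (1/2) (op_powr A (-1/2) x) = x"
    by (simp add: op_powr_apply_apply A op_powr_zero)
  then show "inner (op_powr A (-1/2) x) (A (op_powr A (-1/2) x)) = (norm x)\<^sup>2"
    using norm_op_powr_half[OF A, of "op_powr A (-1/2) x"] by simp
qed

lemma op_le_iff_inner:
  assumes "selfadj A" "selfadj B"
  shows "A \<preceq> B \<longleftrightarrow> (\<forall>x. inner x (A x) \<le> inner x (B x))"
  using selfadj_diff[OF assms(2,1)]
  by (simp add: op_le_def positive_op_iff blinfun.diff_left inner_diff_right)

lemma T_tilde_nonneg: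
  assumes l: "l < 0" and A: "strictly_positive A" and B: "strictly_positive B" and le: "A \<preceq> B"
  shows "positive_op (T_tilde l A B)"
proof -
  let ?C = "op_mean_base A B"
  have C: "strictly_positive ?C" by (rule strictly_positive_op_mean_base[OF A B])
  obtain a b where "between_op a b ?C" using strictly_positive_between[OF C] .
  moreover have "1 * (norm x)\<^sup>2 \<le> inner x (?C x)" for x
    using le unfolding inner_op_mean_base(1)[OF A] inner_op_mean_base(2)[OF A, symmetric] mult_1
    by (simp add: op_le_iff_inner strictly_positive_selfadj A B)
  ultimately have C1: "between_op 1 b ?C" by (simp add: between_op_def)
  \<comment> \<open>As l < 0, x^l lies in [0, 1] for x \<ge> 1. Sandwiching with A^(1/2) turns the
    upper bound 1 into A.\<close>
  have "between_op 0 1 (op_powr ?C l)"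
    unfolding op_powr_def
    by (rule fun_calc_bounds[OF C1 continuous_on_powr_Icc]) (use l powr_mono2'[of l 1] in auto)
  then have "inner x (op_mean l A B x) \<le> inner x (A x)" for x
    using between_op_upper[of 0 1 "op_powr ?C l" "op_powr A (1/2) x"]
    by (simp add: inner_op_mean[OF A B] norm_op_powr_half[OF A])
  then show ?thesis
    using l selfadj_T_tilde[OF A B, of l]
    by (simp add: positive_op_iff T_tilde_op_mean blinfun.scaleR_left blinfun.diff_left inner_diff_right
        divide_nonpos_neg)
qed

lemma T_tilde_nonpos:
  assumes l: "l < 0" and A: "strictly_positive A" and B: "strictly_positive B" and le: "B \<preceq> A"
  shows "positive_op (- T_tilde l A B)"
proof -
  let ?C = "op_mean_base A B"
  have C: "strictly_positive ?C" by (rule strictly_positive_op_mean_base[OF A B])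
  obtain a b where a: "0 < a" and "between_op a b ?C" using strictly_positive_between[OF C] .
  moreover have "inner x (?C x) \<le> 1 * (norm x)\<^sup>2" for x
    using le unfolding inner_op_mean_base(1)[OF A] inner_op_mean_base(2)[OF A, symmetric] mult_1
    by (simp add: op_le_iff_inner strictly_positive_selfadj A B)
  ultimately have C1: "between_op a 1 ?C" by (simp add: between_op_def)
  \<comment> \<open>On [a, 1] the decreasing function x^l runs from a^l down to 1; the lower bound 1
    becomes A after sandwiching.\<close>
  have "between_op 1 (a powr l) (op_powr ?C l)"
    unfolding op_powr_def
  proof (rule fun_calc_bounds[OF C1 continuous_on_powr_Icc[OF a]])
    fix x assume "x \<in> {a..1}"
    then show "1 \<le> x powr l \<and> x powr l \<le> a powr l"
      using a l powr_mono2'[of l x 1] powr_mono2'[of l a x] by auto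
  qed
  then have "inner x (A x) \<le> inner x (op_mean l A B x)" for x
    using between_op_lower[of 1 "a powr l" "op_powr ?C l" "op_powr A (1/2) x"]
    by (simp add: inner_op_mean[OF A B] norm_op_powr_half[OF A])
  moreover have "selfadj (- T_tilde l A B)"
    using selfadj_diff[OF selfadj_zero selfadj_T_tilde[OF A B]] by simp
  ultimately show ?thesis
    using l
    by (simp add: positive_op_iff T_tilde_op_mean blinfun.scaleR_left blinfun.diff_left blinfun.minus_left
        inner_diff_right divide_nonneg_neg)
qed

lemma positive_op_add: "positive_op A \<Longrightarrow> positive_op B \<Longrightarrow> positive_op (A + B)"
  by (simp add: positive_op_iff selfadj_add blinfun.add_left inner_add_right)

lemma positive_op_scaleR: "positive_op A \<Longrightarrow> 0 \<le> r \<Longrightarrow> positive_op (r *\<^sub>R A)"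
  by (simp add: positive_op_iff selfadj_scaleR blinfun.scaleR_left)

text \<open>For B \<le> A the positive operators are the negatives of the \<open>T_tilde\<close>;
  this moves their signs out of the tensor products.\<close>

lemma tensor_op_minus:
  assumes t: "hilbert_tensor t" and A: "selfadj A" and B: "selfadj B"
  shows "tensor_op t (- A) B = - tensor_op t A B" "tensor_op t A (- B) = - tensor_op t A B"
proof -
  interpret t: bounded_bilinear t by (rule bounded_bilinear_hilbert_tensor[OF t])
  have "clinear_op (- tensor_op t A B)"
    using clinear_diff[OF clinear_zero clinear_tensor_op[OF assms]] by simp
  then show "tensor_op t (- A) B = - tensor_op t A B" "tensor_op t A (- B) = - tensor_op t A B"
    by (auto intro!: tensor_op_eqI[OF t] simp: blinfun.minus_left tensor_op_apply[OF assms] t.minus_left t.minus_right)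
qed

theorem proposition5p1:
  fixes tens :: "'a::chilbert_space \<Rightarrow> 'b::chilbert_space \<Rightarrow> 'c::chilbert_space"
    and A1 B1 :: "'a \<Rightarrow>\<^sub>L 'a" and A2 B2 :: "'b \<Rightarrow>\<^sub>L 'b" and l :: real
  assumes tens: "hilbert_tensor tens"
    and l: "l < 0"
    and pos1: "strictly_positive A1" "strictly_positive B1"
    and pos2: "strictly_positive A2" "strictly_positive B2"
  shows "(A1 \<preceq> B1 \<and> A2 \<preceq> B2 \<longrightarrow>
            l *\<^sub>R tensor_op tens (T_tilde l A1 B1) (T_tilde l A2 B2)
              \<preceq> T_tilde l (tensor_op tens A1 A2) (tensor_op tens B1 B2) \<and>
            T_tilde l (tensor_op tens A1 A2) (tensor_op tens B1 B2)
              \<preceq> tensor_op tens (T_tilde l A1 B1) A2 + tensor_op tens A1 (T_tilde l A2 B2))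
       \<and> (B1 \<preceq> A1 \<and> B2 \<preceq> A2 \<longrightarrow>
            T_tilde l (tensor_op tens A1 A2) (tensor_op tens B1 B2)
              \<preceq> l *\<^sub>R tensor_op tens (T_tilde l A1 B1) (T_tilde l A2 B2) \<and>
            T_tilde l (tensor_op tens A1 A2) (tensor_op tens B1 B2)
              \<preceq> tensor_op tens (T_tilde l A1 B1) A2 + tensor_op tens A1 (T_tilde l A2 B2))"
proof -
  let ?T1 = "T_tilde l A1 B1" and ?T2 = "T_tilde l A2 B2"
  let ?D1 = "tensor_op tens ?T1 A2" and ?D2 = "tensor_op tens A1 ?T2"
    and ?M = "tensor_op tens ?T1 ?T2"
  have expand: "T_tilde l (tensor_op tens A1 A2) (tensor_op tens B1 B2) = ?D1 + ?D2 + l *\<^sub>R ?M"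
    using l by (intro T_tilde_tensor_op tens pos1 pos2) simp
  have A: "positive_op A1" "positive_op A2"
    using pos1 pos2 by (simp_all add: strictly_positive_def)
  note sa = selfadj_T_tilde[OF pos1] selfadj_T_tilde[OF pos2]
    strictly_positive_selfadj[OF pos1(1)] strictly_positive_selfadj[OF pos2(1)]
  note minus = tensor_op_minus[OF tens]
  show ?thesis
  proof (intro conjI impI; elim conjE)
    assume "A1 \<preceq> B1" "A2 \<preceq> B2"
    then have T: "positive_op ?T1" "positive_op ?T2"
      by (simp_all add: T_tilde_nonneg l pos1 pos2)
    \<comment> \<open>By \<open>expand\<close>, this sum is the difference of the two sides of
      (a').\<close>
    have "positive_op (?D1 + ?D2)"
      by (intro positive_op_add positive_tensor_op tens A T)
    then show "l *\<^sub>R ?M \<preceq> T_tilde l (tensor_op tens A1 A2) (tensor_op tens B1 B2)"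
      by (simp add: op_le_def expand)
    \<comment> \<open>The difference in (b') is -l times \<open>?M\<close>, with -l > 0.\<close>
    have "positive_op ((- l) *\<^sub>R ?M)"
      using l by (intro positive_op_scaleR positive_tensor_op tens T) simp
    then show "T_tilde l (tensor_op tens A1 A2) (tensor_op tens B1 B2) \<preceq> ?D1 + ?D2"
      by (simp add: op_le_def expand)
  next
    assume "B1 \<preceq> A1" "B2 \<preceq> A2"
    then have T: "positive_op (- ?T1)" "positive_op (- ?T2)"
      by (simp_all add: T_tilde_nonpos l pos1 pos2)
    then have saT: "selfadj (- ?T1)" "selfadj (- ?T2)" by (simp_all add: positive_op_iff)
    have "positive_op (tensor_op tens (- ?T1) A2 + tensor_op tens A1 (- ?T2))"
      by (intro positive_op_add positive_tensor_op tens A T)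
    then show "T_tilde l (tensor_op tens A1 A2) (tensor_op tens B1 B2) \<preceq> l *\<^sub>R ?M"
      by (simp add: op_le_def expand minus sa algebra_simps)
    \<comment> \<open>The two signs cancel, so this is again -l times \<open>?M\<close>; hence (d')
      has the same upper bound as (b'), while (c') reverses (a').\<close>
    have "positive_op ((- l) *\<^sub>R tensor_op tens (- ?T1) (- ?T2))"
      using l by (intro positive_op_scaleR positive_tensor_op tens T) simp
    then show "T_tilde l (tensor_op tens A1 A2) (tensor_op tens B1 B2) \<preceq> ?D1 + ?D2"
      by (simp add: op_le_def expand minus sa saT)
  qed
qed


end
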